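(* Let $\lambda,\mu$ be pure unit quaternions and let $a_l,b_l,c_l,d_l,\tau_l,\eta_l\in\mathbb R$ with $a_ld_l-b_lc_l=1$ and $b_l\neq0$ for $l=1,2$. Let $f,g\in\mathcal S(\mathbb R^2,\mathbb H)$. Then for $k=1,2$, $$\left(\int_{\mathbb R^2}\int_{\mathbb R^2}\left|s_k\,f\!\left(t+\tfrac s2\right)\overline{g\!\left(t-\tfrac s2\right)}\right|_Q^2ds\,dt\right)\left(\int_{\mathbb R^2}\int_{\mathbb R^2}\left\|\frac{\xi_k}{2\pi b_k}\mathcal W^{A_1,A_2}_{f,g}(t,\xi)\right\|_Q^2d\xi\,dt\right)\ \ge\ \frac{1}{16\pi^2}\,|f|_{2,Q}^4\,|g|_{2,Q}^4 .$$
   Context: $\mathbb H$ is the skew field of real quaternions with conjugation $q\mapsto\overline q$ and modulus $|q|_Q=\sqrt{q\overline q}$. A pure unit quaternion is $\lambda\in\mathbb H$ with $\lambda^2=-1$, and $e^{\lambda\theta}=\cos\theta+\lambda\sin\theta$ for $\theta\in\mathbb R$. For $f:\mathbb R^2\to\mathbb H$, $|f|_{2,Q}=\left(\int_{\mathbb R^2}|f(t)|_Q^2\,dt\right)^{1/2}$. $\mathcal S(\mathbb R^2,\mathbb H)$ is the Schwartz space: smooth $f:\mathbb R^2\to\mathbb H$ with $\sup_{x\in\mathbb R^2}(1+|x|^n)|\partial^\alpha f(x)|_Q<\infty$ for all integers $n\ge0$ and all multi-indices $\alpha$. $A_l$ stands for the parameter tuple $(a_l,b_l,c_l,d_l,\tau_l,\eta_l)$.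 For $b_l\neq0$ and a pure unit quaternion $\nu$, the kernel is $$K^{\nu}_{A_l}(x,y)=\frac{1}{\sqrt{\nu 2\pi b_l}}\exp\!\Big(\frac{\nu}{2b_l}\big(a_lx^2-2x(y-\tau_l)-2y(d_l\tau_l-b_l\eta_l)+d_l(y^2+\tau_l^2)\big)\Big),\qquad x,y\in\mathbb R,$$ where $\frac1{\sqrt\nu}=e^{-\nu\pi/4}$; square roots are principal square roots in the copy $\mathbb R+\mathbb R\nu$ of $\mathbb C$, so that the prefactor has modulus $(2\pi|b_l|)^{-1/2}$. The two-sided quaternionic offset linear canonical transform (QOLCT) of $h\in L^1(\mathbb R^2,\mathbb H)$ is, for $b_1,b_2\neq0$, $\mathcal O^{\lambda,\mu}_{A_1,A_2}\{h\}(\xi)=\int_{\mathbb R^2}K^{\lambda}_{A_1}(s_1,\xi_1)h(s)K^{\mu}_{A_2}(s_2,\xi_2)\,ds$. Put $h_{f,g}(t,s)=f(t+\frac s2)\overline{g(t-\frac s2)}$, $t,s\in\mathbb R^2$. The Wigner-Ville distribution associated with the QOLCT (WVD-QOLCT) is $\mathcal W^{A_1,A_2}_{f,g}(t,\xi)=\mathcal O^{\lambda,\mu}_{A_1,A_2}\{h_{f,g}(t,\cdot)\}(\xi)$. The norm $\|\cdot\|_Q$ is taken component-wise in the input: writing $h_{f,g}=h_0+ih_1+jh_2+kh_3$ with real-valued $h_m$, $\|\mathcal W^{A_1,A_2}_{f,g}(t,\xi)\|_Q=\Big(\sum_{m=0}^3|\mathcal O^{\lambda,\mu}_{A_1,A_2}\{h_m(t,\cdot)\}(\xi)|_Q^2\Big)^{1/2}$,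 and $\|c\,\mathcal W^{A_1,A_2}_{f,g}(t,\xi)\|_Q=|c|\,\|\mathcal W^{A_1,A_2}_{f,g}(t,\xi)\|_Q$ for real $c$. *)

theory Defs
  imports "HOL-Analysis.Analysis"
begin

section \<open>Quaternions\<close>

datatype quat = Quat (qre: real) (qi: real) (qj: real) (qk: real)

lemma quat_eq_iff: "x = y \<longleftrightarrow> qre x = qre y \<and> qi x = qi y \<and> qj x = qj y \<and> qk x = qk y"
  by (cases x; cases y) simp

instantiation quat :: ab_group_add
begin

definition "0 = Quat 0 0 0 0"
definition "x + y = Quat (qre x + qre y) (qi x + qi y) (qj x + qj y) (qk x + qk y)"
definition "- x = Quat (- qre x) (- qi x) (- qj x) (- qk x)"
definition "x - y = Quat (qre x - qre y) (qi x - qi y) (qj x - qj y) (qk x - qk y)"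

instance
  by standard
    (simp_all add: quat_eq_iff zero_quat_def plus_quat_def uminus_quat_def minus_quat_def)

end

lemma quat_group_sel [simp]:
  "qre 0 = 0" "qi 0 = 0" "qj 0 = 0" "qk 0 = 0"
  "qre (x + y) = qre x + qre y" "qi (x + y) = qi x + qi y"
  "qj (x + y) = qj x + qj y" "qk (x + y) = qk x + qk y"
  "qre (- x) = - qre x" "qi (- x) = - qi x" "qj (- x) = - qj x" "qk (- x) = - qk x"
  "qre (x - y) = qre x - qre y" "qi (x - y) = qi x - qi y"
  "qj (x - y) = qj x - qj y" "qk (x - y) = qk x - qk y"
  by (simp_all add: zero_quat_def plus_quat_def uminus_quat_def minus_quat_def)

instantiation quat :: real_algebra_1
begin

definition "1 = Quat 1 0 0 0"
definition "x * y = Quat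
  (qre x * qre y - qi x * qi y - qj x * qj y - qk x * qk y)
  (qre x * qi y + qi x * qre y + qj x * qk y - qk x * qj y)
  (qre x * qj y - qi x * qk y + qj x * qre y + qk x * qi y)
  (qre x * qk y + qi x * qj y - qj x * qi y + qk x * qre y)"
definition "scaleR r x = Quat (r * qre x) (r * qi x) (r * qj x) (r * qk x)"

instance
  by standard
    (simp_all add: quat_eq_iff one_quat_def times_quat_def scaleR_quat_def algebra_simps)

end

lemma quat_alg_sel [simp]:
  "qre 1 = 1" "qi 1 = 0" "qj 1 = 0" "qk 1 = 0"
  "qre (r *\<^sub>R x) = r * qre x" "qi (r *\<^sub>R x) = r * qi x"
  "qj (r *\<^sub>R x) = r * qj x" "qk (r *\<^sub>R x) = r * qk x"
  by (simp_all add: one_quat_def scaleR_quat_def)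

lemma quat_times_sel:
  "qre (x * y) = qre x * qre y - qi x * qi y - qj x * qj y - qk x * qk y"
  "qi (x * y) = qre x * qi y + qi x * qre y + qj x * qk y - qk x * qj y"
  "qj (x * y) = qre x * qj y - qi x * qk y + qj x * qre y + qk x * qi y"
  "qk (x * y) = qre x * qk y + qi x * qj y - qj x * qi y + qk x * qre y"
  by (simp_all add: times_quat_def)

lemma quat_of_real_sel [simp]:
  "qre (of_real r) = r" "qi (of_real r) = 0" "qj (of_real r) = 0" "qk (of_real r) = 0"
  by (simp_all add: of_real_def)

definition qcnj :: "quat \<Rightarrow> quat" where
  "qcnj x = Quat (qre x) (- qi x) (- qj x) (- qk x)"

lemma quat_cnj_sel [simp]:
  "qre (qcnj x) = qre x" "qi (qcnj x) = - qi x" "qj (qcnj x) = - qj x" "qk (qcnj x) = - qk x"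
  by (simp_all add: qcnj_def)

instantiation quat :: real_inner
begin

definition "inner x y = qre x * qre y + qi x * qi y + qj x * qj y + qk x * qk y"
definition "norm (x::quat) = sqrt (inner x x)"
definition "sgn (x::quat) = x /\<^sub>R norm x"
definition "dist (x::quat) y = norm (x - y)"
definition uniformity_quat_def [code del]:
  "(uniformity :: (quat \<times> quat) filter) = (INF e\<in>{0 <..}. principal {(x, y). dist x y < e})"
definition open_quat_def [code del]:
  "open (U :: quat set) \<longleftrightarrow> (\<forall>x\<in>U. eventually (\<lambda>(x', y). x' = x \<longrightarrow> y \<in> U) uniformity)"

instance
proof
  fix x y z :: quat and r :: real
  show "inner x y = inner y x" "inner (x + y) z = inner x z + inner y z"
    "inner (r *\<^sub>R x) y = r * inner x y"
    by (simp_all add: inner_quat_def algebra_simps)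
  show "0 \<le> inner x x"
    by (simp add: inner_quat_def)
  show "inner x x = 0 \<longleftrightarrow> x = 0"
  proof
    assume "inner x x = 0"
    then have *: "qre x * qre x + qi x * qi x + qj x * qj x + qk x * qk x = 0"
      by (simp add: inner_quat_def)
    have "0 \<le> qre x * qre x" "0 \<le> qi x * qi x" "0 \<le> qj x * qj x" "0 \<le> qk x * qk x"
      by simp_all
    with * have "qre x * qre x = 0" "qi x * qi x = 0" "qj x * qj x = 0" "qk x * qk x = 0"
      by linarith+
    then show "x = 0"
      by (simp add: quat_eq_iff)
  qed (simp add: inner_quat_def)
qed (rule norm_quat_def sgn_quat_def dist_quat_def open_quat_def uniformity_quat_def)+

end

lemma norm_quat_eq: "norm x = sqrt ((qre x)\<^sup>2 + (qi x)\<^sup>2 + (qj x)\<^sup>2 + (qk x)\<^sup>2)"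
  by (simp add: norm_quat_def inner_quat_def power2_eq_square)

lemma quat_mult_cnj: "x * qcnj x = of_real ((norm x)\<^sup>2)"
  by (simp add: quat_eq_iff quat_times_sel norm_quat_eq power2_eq_square)

lemma quat_cnj_mult: "qcnj x * x = of_real ((norm x)\<^sup>2)"
  by (simp add: quat_eq_iff quat_times_sel norm_quat_eq power2_eq_square)

lemma qcnj_mult: "qcnj (x * y) = qcnj y * qcnj x"
  by (simp add: quat_eq_iff quat_times_sel)

instantiation quat :: real_normed_div_algebra
begin

definition "inverse x = qcnj x /\<^sub>R (norm x)\<^sup>2"
definition "x div y = x * inverse y" for x y :: quat

instance
proof
  fix x y :: quat
  show "x \<noteq> 0 \<Longrightarrow> inverse x * x = 1" "x \<noteq> 0 \<Longrightarrow> x * inverse x = 1"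
    by (simp_all add: inverse_quat_def quat_mult_cnj quat_cnj_mult del: of_real_power)
      (simp_all add: of_real_def)
  show "x div y = x * inverse y"
    by (rule divide_quat_def)
  show "inverse (0::quat) = 0"
    by (simp add: inverse_quat_def)
  have "of_real ((norm (x * y))\<^sup>2) = x * (y * qcnj y) * qcnj x"
    by (simp only: qcnj_mult mult.assoc flip: quat_mult_cnj)
  also have "\<dots> = of_real ((norm y)\<^sup>2) * (x * qcnj x)"
    by (simp only: quat_mult_cnj of_real_def mult_scaleR_right
        mult_scaleR_left mult_1_left mult_1_right scaleR_scaleR mult.commute)
  also have "\<dots> = of_real ((norm x * norm y)\<^sup>2)"
    by (simp only: quat_mult_cnj power_mult_distrib mult.commute flip: of_real_mult)
  finally have "(norm (x * y))\<^sup>2 = (norm x * norm y)\<^sup>2"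
    by (simp only: of_real_eq_iff)
  then show "norm (x * y) = norm x * norm y"
    by (simp add: power2_eq_iff_nonneg)
qed

end

instantiation quat :: euclidean_space
begin

definition "Basis = {Quat 1 0 0 0, Quat 0 1 0 0, Quat 0 0 1 0, Quat 0 0 0 1}"

instance
proof
  show "(Basis :: quat set) \<noteq> {}" "finite (Basis :: quat set)"
    by (simp_all add: Basis_quat_def)
  fix u v :: quat
  assume "u \<in> Basis" "v \<in> Basis"
  then show "inner u v = (if u = v then 1 else 0)"
    unfolding Basis_quat_def by (elim insertE emptyE) (simp_all add: inner_quat_def)
next
  fix x :: quat
  show "(\<forall>u\<in>Basis. inner x u = 0) \<longleftrightarrow> x = 0"
    by (cases x) (simp add: Basis_quat_def inner_quat_def zero_quat_def)
qed

end


section \<open>The copy of the complex numbers generated by a pure unit quaternion\<close>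

definition pure_unit :: "quat \<Rightarrow> bool" where
  "pure_unit \<nu> \<longleftrightarrow> \<nu>\<^sup>2 = -1"

definition qembed :: "quat \<Rightarrow> complex \<Rightarrow> quat" where
  "qembed \<nu> z = of_real (Re z) + Im z *\<^sub>R \<nu>"

definition qexp :: "quat \<Rightarrow> real \<Rightarrow> quat" where
  "qexp \<nu> \<theta> = of_real (cos \<theta>) + sin \<theta> *\<^sub>R \<nu>"

lemma qexp_eq: "qexp \<nu> \<theta> = qembed \<nu> (cis \<theta>)"
  by (simp add: qexp_def qembed_def)

lemma qembed_of_real_cis: "qembed \<nu> (of_real r * cis \<theta>) = r *\<^sub>R qexp \<nu> \<theta>"
  by (simp add: qembed_def qexp_def of_real_def scaleR_add_right)

lemma qembed_mult:
  assumes "pure_unit \<nu>"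
  shows "qembed \<nu> (z * w) = qembed \<nu> z * qembed \<nu> w"
proof -
  have "\<nu> * \<nu> = -1"
    using assms by (simp add: pure_unit_def power2_eq_square)
  then show ?thesis
    by (simp add: qembed_def of_real_def distrib_left distrib_right scaleR_add_left
        scaleR_add_right scaleR_diff_left scaleR_diff_right mult.commute)
qed

lemma pure_unit_norm:
  assumes "pure_unit \<nu>"
  shows "qre \<nu> = 0" "norm \<nu> = 1"
proof -
  have "norm \<nu> * norm \<nu> = 1"
    using assms by (metis norm_mult norm_minus_cancel norm_one power2_eq_square pure_unit_def)
  then show 1: "norm \<nu> = 1"
    by (metis abs_norm_cancel abs_square_eq_1 power2_eq_square)
  have "qre (\<nu> * \<nu>) = -1"
    using assms by (simp add: pure_unit_def power2_eq_square)
  with 1 have "qre \<nu> * qre \<nu> = 0"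
    unfolding quat_times_sel norm_quat_eq power2_eq_square real_sqrt_eq_1_iff by linarith
  then show "qre \<nu> = 0"
    by simp
qed

lemma norm_qembed:
  assumes "pure_unit \<nu>"
  shows "norm (qembed \<nu> z) = norm z"
proof -
  have 1: "(qi \<nu>)\<^sup>2 + (qj \<nu>)\<^sup>2 + (qk \<nu>)\<^sup>2 = 1"
    using pure_unit_norm[OF assms] by (simp add: norm_quat_eq)
  have "(norm (qembed \<nu> z))\<^sup>2 = (Re z)\<^sup>2 + (Im z)\<^sup>2 * ((qi \<nu>)\<^sup>2 + (qj \<nu>)\<^sup>2 + (qk \<nu>)\<^sup>2)"
    by (simp add: norm_quat_eq qembed_def pure_unit_norm[OF assms] power_mult_distrib algebra_simps)
  then show ?thesis
    unfolding 1 by (simp add: cmod_def real_sqrt_unique)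
qed


section \<open>Schwartz functions and the \<open>L\<^sup>2\<close> norm\<close>

definition partial :: "2 \<Rightarrow> (real^2 \<Rightarrow> quat) \<Rightarrow> real^2 \<Rightarrow> quat" where
  "partial k f x = frechet_derivative f (at x) (axis k 1)"

text \<open>Every iterated partial derivative, in any order of directions (the empty list gives \<open>f\<close>), is
  Frechet differentiable everywhere; in particular \<open>partial\<close> is never applied where
  \<^const>\<open>frechet_derivative\<close> is unspecified.\<close>
definition smooth :: "(real^2 \<Rightarrow> quat) \<Rightarrow> bool" where
  "smooth f \<longleftrightarrow> (\<forall>ks x. foldr partial ks f differentiable (at x))"

definition mpartial :: "(2 \<Rightarrow> nat) \<Rightarrow> (real^2 \<Rightarrow> quat) \<Rightarrow> real^2 \<Rightarrow> quat" where
  "mpartial \<alpha> f = (partial 1 ^^ \<alpha> 1) ((partial 2 ^^ \<alpha> 2) f)"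

definition schwartz :: "(real^2 \<Rightarrow> quat) \<Rightarrow> bool" where
  "schwartz f \<longleftrightarrow> smooth f \<and>
    (\<forall>n \<alpha>. bdd_above (range (\<lambda>x. (1 + norm x ^ n) * norm (mpartial \<alpha> f x))))"

definition l2norm :: "(real^2 \<Rightarrow> quat) \<Rightarrow> real" where
  "l2norm f = sqrt (LINT t|lborel. (norm (f t))\<^sup>2)"


section \<open>The offset linear canonical transform and its Wigner-Ville distribution\<close>

text \<open>The tuple is \<open>(a, b, c, d, \<tau>, \<eta>)\<close>.\<close>
type_synonym olct_param = "real \<times> real \<times> real \<times> real \<times> real \<times> real"

text \<open>For \<open>b < 0\<close> the principal root of \<open>\<nu> 2 \<pi> b\<close> in \<open>\<real> + \<real>\<nu>\<close> has argument \<open>- \<pi> / 4\<close>; for \<open>b > 0\<close>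
  the prefactor is \<open>exp (- \<nu> \<pi> / 4) / sqrt (2 \<pi> b)\<close>.\<close>
fun olct_kernel :: "quat \<Rightarrow> olct_param \<Rightarrow> real \<Rightarrow> real \<Rightarrow> quat" where
  "olct_kernel \<nu> (a, b, c, d, \<tau>, \<eta>) x y =
     qembed \<nu> (1 / csqrt (\<i> * of_real (2 * pi * b))) *
     qexp \<nu> (1 / (2 * b) *
       (a * x\<^sup>2 - 2 * x * (y - \<tau>) - 2 * y * (d * \<tau> - b * \<eta>) + d * (y\<^sup>2 + \<tau>\<^sup>2)))"

lemma norm_olct_kernel:
  assumes "pure_unit \<nu>"
  shows "norm (olct_kernel \<nu> (a, b, c, d, \<tau>, \<eta>) x y) = 1 / sqrt (2 * pi * \<bar>b\<bar>)"
  by (simp add: norm_mult norm_qembed[OF assms] qexp_eq norm_divide abs_mult)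

lemma olct_prefactor_pos:
  assumes "b > 0"
  shows "qembed \<nu> (1 / csqrt (\<i> * of_real (2 * pi * b))) = qexp \<nu> (- pi / 4) /\<^sub>R sqrt (2 * pi * b)"
proof -
  have "csqrt (\<i> * of_real (2 * pi * b)) = of_real (sqrt (2 * pi * b)) * cis (pi / 4)"
  proof (rule csqrt_unique)
    have "(cis (pi / 4))\<^sup>2 = \<i>"
      by (simp add: power2_eq_square cis_mult flip: cis_pi_half)
    then show "(of_real (sqrt (2 * pi * b)) * cis (pi / 4))\<^sup>2 = \<i> * of_real (2 * pi * b)"
      using assms by (simp add: power_mult_distrib flip: of_real_power)
    show "0 < Re (of_real (sqrt (2 * pi * b)) * cis (pi / 4)) \<or>
      Re (of_real (sqrt (2 * pi * b)) * cis (pi / 4)) = 0 \<and>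
      0 \<le> Im (of_real (sqrt (2 * pi * b)) * cis (pi / 4))"
      using assms by (simp add: cos_45)
  qed
  then have "1 / csqrt (\<i> * of_real (2 * pi * b)) =
      inverse (of_real (sqrt (2 * pi * b))) * inverse (cis (pi / 4))"
    by (simp only: divide_inverse inverse_mult_distrib mult_1_left)
  also have "\<dots> = of_real (inverse (sqrt (2 * pi * b))) * cis (- pi / 4)"
    by (simp only: cis_inverse of_real_inverse minus_divide_left)
  finally have *: "1 / csqrt (\<i> * of_real (2 * pi * b)) =
      of_real (inverse (sqrt (2 * pi * b))) * cis (- pi / 4)" .
  show ?thesis
    unfolding * by (rule qembed_of_real_cis)
qed

definition qolct ::
  "quat \<Rightarrow> quat \<Rightarrow> olct_param \<Rightarrow> olct_param \<Rightarrow> (real^2 \<Rightarrow> quat) \<Rightarrow> real^2 \<Rightarrow> quat" where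
  "qolct \<nu> \<mu> A1 A2 h \<xi> =
     (LINT s|lborel. olct_kernel \<nu> A1 (s $ 1) (\<xi> $ 1) * h s * olct_kernel \<mu> A2 (s $ 2) (\<xi> $ 2))"

definition wvd_corr :: "(real^2 \<Rightarrow> quat) \<Rightarrow> (real^2 \<Rightarrow> quat) \<Rightarrow> real^2 \<Rightarrow> real^2 \<Rightarrow> quat" where
  "wvd_corr f g t s = f (t + s /\<^sub>R 2) * qcnj (g (t - s /\<^sub>R 2))"

definition wvd_qolct :: "quat \<Rightarrow> quat \<Rightarrow> olct_param \<Rightarrow> olct_param \<Rightarrow>
    (real^2 \<Rightarrow> quat) \<Rightarrow> (real^2 \<Rightarrow> quat) \<Rightarrow> real^2 \<Rightarrow> real^2 \<Rightarrow> quat" where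
  "wvd_qolct \<nu> \<mu> A1 A2 f g t \<xi> = qolct \<nu> \<mu> A1 A2 (wvd_corr f g t) \<xi>"

text \<open>This norm is not a function of the value \<open>wvd_qolct \<nu> \<mu> A1 A2 f g t \<xi>\<close>: it transforms the
  four real components of the input \<open>wvd_corr f g t\<close> separately.  The scalar \<open>r\<close> enters by
  homogeneity, so \<open>wvd_norm r \<nu> \<mu> A1 A2 f g t \<xi>\<close> is the norm of \<open>r\<close> times the distribution.\<close>
definition wvd_norm :: "real \<Rightarrow> quat \<Rightarrow> quat \<Rightarrow> olct_param \<Rightarrow> olct_param \<Rightarrow>
    (real^2 \<Rightarrow> quat) \<Rightarrow> (real^2 \<Rightarrow> quat) \<Rightarrow> real^2 \<Rightarrow> real^2 \<Rightarrow> real" where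
  "wvd_norm r \<nu> \<mu> A1 A2 f g t \<xi> = \<bar>r\<bar> * sqrt (
      (norm (qolct \<nu> \<mu> A1 A2 (\<lambda>s. of_real (qre (wvd_corr f g t s))) \<xi>))\<^sup>2
    + (norm (qolct \<nu> \<mu> A1 A2 (\<lambda>s. of_real (qi (wvd_corr f g t s))) \<xi>))\<^sup>2
    + (norm (qolct \<nu> \<mu> A1 A2 (\<lambda>s. of_real (qj (wvd_corr f g t s))) \<xi>))\<^sup>2
    + (norm (qolct \<nu> \<mu> A1 A2 (\<lambda>s. of_real (qk (wvd_corr f g t s))) \<xi>))\<^sup>2)"

lemma wvd_norm_real_input:
  assumes "\<And>s. wvd_corr f g t s \<in> \<real>"
  shows "wvd_norm r \<nu> \<mu> A1 A2 f g t \<xi> = norm (r *\<^sub>R wvd_qolct \<nu> \<mu> A1 A2 f g t \<xi>)"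
proof -
  have *: "of_real (qre (wvd_corr f g t s)) = wvd_corr f g t s" "qi (wvd_corr f g t s) = 0"
    "qj (wvd_corr f g t s) = 0" "qk (wvd_corr f g t s) = 0" for s
    using assms[of s] by (auto elim!: Reals_cases)
  show ?thesis
    unfolding wvd_norm_def wvd_qolct_def * by (simp add: qolct_def)
qed

end

theory Submission
  imports Defs "HOL-Probability.Characteristic_Functions" "HOL-Probability.Sinc_Integral"
begin

text \<open>For real \<open>h\<close>, the squared modulus of the two-sided transform of \<open>h\<close> is a convex combination, with weights
  \<open>(1 \<plusminus> \<nu> \<bullet> \<mu>) / 2\<close>, of squared moduli of two complex Fourier transforms of \<open>h\<close> times a chirp.  The lower half
  of Plancherel's theorem, applied to the derivative of \<open>h\<close> times the chirp, therefore bounds the second factor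
  of the product from below by \<open>1 / (4 * pi\<^sup>2)\<close> times \<open>\<integral>\<integral> |\<partial>\<^sub>k h|\<^sup>2\<close>, where now \<open>h(t,s) = f(t + s/2) cnj(g(t - s/2))\<close>.
  Integrating \<open>0 \<le> |r s\<^sub>k h + \<partial>\<^sub>k h|\<^sup>2\<close> by parts in \<open>s\<close> for every real \<open>r\<close> and taking the discriminant gives
  \<open>(\<integral>\<integral> |h|\<^sup>2)\<^sup>2 \<le> 4 \<integral>\<integral> |s\<^sub>k h|\<^sup>2 \<integral>\<integral> |\<partial>\<^sub>k h|\<^sup>2\<close>, and \<open>(t, s) \<mapsto> (t + s/2, t - s/2)\<close> has Jacobian \<open>1\<close> in modulus, so
  that \<open>\<integral>\<integral> |h|\<^sup>2 = |f|\<^sup>2 |g|\<^sup>2\<close>.\<close>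

section \<open>Affine substitutions and Gaussian integrals on the plane\<close>

text \<open>The obstacle is that \<open>\<nu>\<close> and \<open>\<mu>\<close> need neither commute
  nor be orthogonal, so the two exponentials do not merge into one. For real input the product of
  exponentials expands in 1, \<open>\<nu>\<close>, \<open>\<mu>\<close>,
  \<open>\<nu> * \<mu>\<close>, whose only possibly non-zero mixed inner products are
  \<open>\<nu> \<bullet> \<mu>\<close> and its negative. The component-wise norm is what permits
  real input: it adds four real estimates, and the squared derivatives of the four components add up
  to that of h. The frequency factor is only bounded from below. It is therefore kept as an integral
  with values in [0, \<infinity>] that is never shown to be finite, and one direction of Plancherel
  suffices. Constants: the kernels contribute 1 / ((2 pi)^2 |b_1 b_2|), Plancherel with frequencies
  scaled by 1 / b_l contributes (2 pi)^2 |b_1 b_2|, and these cancel. What remains is the square of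
  the 1 / (2 pi) in \<xi>_k / (2 pi b_k); the discriminant supplies the other 1/4.\<close>

lemma nn_integral_lborel_affine:
  fixes G :: "'a::euclidean_space \<Rightarrow> ennreal"
  assumes [measurable]: "G \<in> borel_measurable borel" and "c \<noteq> 0"
  shows "(\<integral>\<^sup>+x. G x \<partial>lborel) = ennreal (\<bar>c\<bar> ^ DIM('a)) * (\<integral>\<^sup>+x. G (t + c *\<^sub>R x) \<partial>lborel)"
  by (subst lborel_affine[OF assms(2), of t])
    (simp add: nn_integral_density nn_integral_distr nn_integral_cmult ennreal_power)

text \<open>Needed for the passage from the frequency \<xi> to (\<xi>_1 / b_1, \<plusminus> \<xi>_2
  / b_2): each coordinate has its own factor and sign, which a scalar dilation cannot
  provide.\<close>

lemma nn_integral_lborel_scale_coords: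
  fixes G :: "real^'n \<Rightarrow> ennreal" and \<beta> :: "real^'n"
  assumes [measurable]: "G \<in> borel_measurable borel" and \<beta>: "\<And>i. \<beta> $ i \<noteq> 0"
  shows "(\<integral>\<^sup>+x. G x \<partial>lborel) = ennreal (\<Prod>i\<in>UNIV. \<bar>\<beta> $ i\<bar>) * (\<integral>\<^sup>+x. G (\<chi> i. \<beta> $ i * x $ i) \<partial>lborel)"
proof -
  \<comment> \<open>This shape, with the zero shift, is the one for which
    \<open>lborel_affine_euclidean\<close> is stated.\<close>
  define T where "T x = 0 + (\<Sum>j\<in>Basis. ((\<beta> \<bullet> j) * (x \<bullet> j)) *\<^sub>R j)" for x :: "real^'n"
  have T: "T x = (\<chi> i. \<beta> $ i * x $ i)" for x
  proof (rule euclidean_eqI)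
    fix j :: "real^'n"
    assume j: "j \<in> Basis"
    then obtain i where i: "j = axis i 1"
      by (auto simp: Basis_vec_def)
    have "T x \<bullet> j = (\<beta> \<bullet> j) * (x \<bullet> j)"
      using j by (simp add: T_def inner_sum_left_Basis)
    then show "T x \<bullet> j = (\<chi> i. \<beta> $ i * x $ i) \<bullet> j"
      by (simp add: i inner_axis)
  qed
  have Tm[measurable]: "T \<in> borel_measurable borel"
    unfolding T_def[abs_def] by measurable
  have p: "(\<Prod>j\<in>Basis. \<bar>\<beta> \<bullet> j\<bar>) = (\<Prod>i\<in>UNIV. \<bar>\<beta> $ i\<bar>)"
  proof -
    have B: "(Basis :: (real^'n) set) = (\<lambda>i. axis i 1) ` UNIV"
      by (auto simp: Basis_vec_def)
    have "inj (\<lambda>i::'n. axis i (1::real))"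
      by (auto simp: inj_def axis_eq_axis)
    then show ?thesis
      unfolding B by (subst prod.reindex) (auto simp: inner_axis)
  qed
  have "\<And>j. j \<in> Basis \<Longrightarrow> \<beta> \<bullet> j \<noteq> 0"
    using \<beta> by (auto simp: Basis_vec_def inner_axis)
  from lborel_affine_euclidean[of "(\<bullet>) \<beta>" 0, OF this]
  have "lborel = density (distr lborel borel T) (\<lambda>_. ennreal (\<Prod>i\<in>UNIV. \<bar>\<beta> $ i\<bar>))"
    unfolding T_def[abs_def] p[symmetric] by (simp add: prod_ennreal)
  then have "(\<integral>\<^sup>+x. G x \<partial>lborel) =
      (\<integral>\<^sup>+x. G x \<partial>density (distr lborel borel T) (\<lambda>_. ennreal (\<Prod>i\<in>UNIV. \<bar>\<beta> $ i\<bar>)))"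
    by simp
  also have "\<dots> = ennreal (\<Prod>i\<in>UNIV. \<bar>\<beta> $ i\<bar>) * (\<integral>\<^sup>+x. G (T x) \<partial>lborel)"
    by (simp add: nn_integral_density nn_integral_distr nn_integral_cmult)
  finally show ?thesis
    by (simp add: T)
qed

lemma integral_lborel_affine:
  fixes u :: "'a::euclidean_space \<Rightarrow> 'b::{banach, second_countable_topology}"
  assumes "u \<in> borel_measurable borel" and "c \<noteq> 0"
  shows "(LINT x|lborel. u x) = \<bar>c\<bar> ^ DIM('a) *\<^sub>R (LINT x|lborel. u (t + c *\<^sub>R x))"
proof -
  have [measurable]: "u \<in> borel_measurable borel" by fact
  have "(LINT x|lborel. u x) =
     (LINT x|density (distr lborel borel (\<lambda>x. t + c *\<^sub>R x)) (\<lambda>_. ennreal (\<bar>c\<bar> ^ DIM('a))). u x)"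
    using lborel_affine[OF assms(2), of t] by (simp add: ennreal_power)
  also have "\<dots> = \<bar>c\<bar> ^ DIM('a) *\<^sub>R (LINT x|lborel. u (t + c *\<^sub>R x))"
    by (simp add: integral_density integral_distr)
  finally show ?thesis .
qed

lemma integrable_lborel_affine:
  fixes u :: "'a::euclidean_space \<Rightarrow> 'b::{banach, second_countable_topology}"
  assumes "integrable lborel u" and "c \<noteq> 0"
  shows "integrable lborel (\<lambda>x. u (t + c *\<^sub>R x))"
proof -
  have [measurable]: "u \<in> borel_measurable borel"
    using assms by auto
  have "integrable (density (distr lborel borel (\<lambda>x. t + c *\<^sub>R x)) (\<lambda>_. ennreal (\<bar>c\<bar> ^ DIM('a)))) u"
    using assms(1) lborel_affine[OF assms(2), of t] by (simp add: ennreal_power)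
  then have "integrable lborel (\<lambda>x. \<bar>c\<bar> ^ DIM('a) *\<^sub>R u (t + c *\<^sub>R x))"
    by (simp add: integrable_density integrable_distr_eq)
  then have "integrable lborel (\<lambda>x. inverse (\<bar>c\<bar> ^ DIM('a)) *\<^sub>R (\<bar>c\<bar> ^ DIM('a) *\<^sub>R u (t + c *\<^sub>R x)))"
    by (rule integrable_scaleR_right)
  moreover have "inverse (\<bar>c\<bar> ^ DIM('a)) *\<^sub>R (\<bar>c\<bar> ^ DIM('a) *\<^sub>R v) = v" for v :: 'b
    using assms(2) by simp
  ultimately show ?thesis
    by (simp only:)
qed

text \<open>This is exp(-|x|^2 / 2) / (2 pi), written as a product so that its integrals reduce to
  the line. Its Fourier transform is \<open>2 * pi\<close> times itself, which lets it serve both as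
  the cutoff in frequency and as the approximate identity in space.\<close>

definition gauss2 :: "real^2 \<Rightarrow> real" where
  "gauss2 x = std_normal_density (x $ 1) * std_normal_density (x $ 2)"

section \<open>Fubini's theorem carried from pairs of reals to vectors\<close>

lemma borel_measurable_vector2:
  "(\<lambda>p::real\<times>real. vector [fst p, snd p] :: real^2) \<in> borel_measurable borel"
proof -
  have "(\<lambda>p::real\<times>real. vector [fst p, snd p] :: real^2) = (\<lambda>p. fst p *\<^sub>R axis 1 1 + snd p *\<^sub>R axis 2 1)"
    by (auto simp: vec_eq_iff forall_2 axis_def fun_eq_iff)
  then show ?thesis
    by (simp add: borel_measurable_continuous_onI continuous_intros)
qed

lemma borel_measurable_cis [measurable]: "cis \<in> borel_measurable borel"
  by (intro borel_measurable_continuous_onI continuous_on_cis continuous_on_id)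

lemma borel_measurable_cnj [measurable]: "cnj \<in> borel_measurable borel"
  by (intro borel_measurable_continuous_onI continuous_on_cnj continuous_on_id)

text \<open>Lebesgue measure is determined by its values on boxes, and the preimage of a box in
  \<open>real^2\<close> is a product of two intervals. Through this identity an integral over
  \<open>real^2\<close> becomes an iterated one.\<close>

lemma lborel_vec2:
  "(lborel :: (real^2) measure) = distr (lborel \<Otimes>\<^sub>M lborel) borel (\<lambda>p. vector [fst p, snd p])"
proof (rule lborel_eqI)
  have m: "(\<lambda>p::real\<times>real. vector [fst p, snd p] :: real^2) \<in> borel_measurable borel"
    by (rule borel_measurable_vector2)
  show "sets (distr (lborel \<Otimes>\<^sub>M lborel) borel (\<lambda>p::real\<times>real. vector [fst p, snd p] :: real^2)) = sets borel"
    by simp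
  fix l u :: "real^2"
  assume le: "\<And>b. b \<in> Basis \<Longrightarrow> l \<bullet> b \<le> u \<bullet> b"
  have B: "(Basis :: (real^2) set) = {axis 1 1, axis 2 1}"
    by (auto simp: Basis_vec_def UNIV_2)
  have ne: "axis 1 1 \<noteq> (axis 2 1 :: real^2)"
    by (simp add: axis_eq_axis)
  have le': "l $ 1 \<le> u $ 1" "l $ 2 \<le> u $ 2"
    using le[of "axis 1 1"] le[of "axis 2 1"] by (auto simp: inner_axis)
  have "(\<lambda>p::real\<times>real. vector [fst p, snd p] :: real^2) -` box l u = {l$1<..<u$1} \<times> {l$2<..<u$2}"
    by (auto simp: box_def B inner_axis vector_2)
  then have "emeasure (distr (lborel \<Otimes>\<^sub>M lborel) borel (\<lambda>p::real\<times>real. vector [fst p, snd p] :: real^2)) (box l u)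
      = emeasure (lborel \<Otimes>\<^sub>M lborel) ({l$1<..<u$1} \<times> {l$2<..<u$2})"
    using m by (subst emeasure_distr) (auto simp: lborel_prod)
  also have "\<dots> = ennreal ((u$1 - l$1) * (u$2-l$2))"
    using le' by (subst lborel.emeasure_pair_measure_Times) (auto simp: ennreal_mult)
  also have "\<dots> = (\<Prod>b\<in>Basis. (u - l) \<bullet> b)"
    using ne by (simp add: B inner_axis)
  finally show "emeasure (distr (lborel \<Otimes>\<^sub>M lborel) borel (\<lambda>p::real\<times>real. vector [fst p, snd p] :: real^2)) (box l u) = (\<Prod>b\<in>Basis. (u - l) \<bullet> b)" .
qed

lemma
  fixes \<phi> \<psi> :: "real \<Rightarrow> 'b::{real_normed_field, banach, second_countable_topology}"
  assumes \<phi>: "integrable lborel \<phi>" and \<psi>: "integrable lborel \<psi>"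
  shows integrable_vec2_mult: "integrable lborel (\<lambda>x::real^2. \<phi> (x $ 1) * \<psi> (x $ 2))"
    and integral_vec2_mult: "(LINT x::real^2|lborel. \<phi> (x $ 1) * \<psi> (x $ 2)) = (LINT x|lborel. \<phi> x) * (LINT x|lborel. \<psi> x)"
proof -
  have [measurable]: "\<phi> \<in> borel_measurable borel" "\<psi> \<in> borel_measurable borel"
    using \<phi> \<psi> by auto
  have m[measurable]: "(\<lambda>p::real\<times>real. vector [fst p, snd p] :: real^2) \<in> borel_measurable borel"
    by (rule borel_measurable_vector2)
  have [measurable]: "(\<lambda>p::real\<times>real. vector [fst p, snd p] :: real^2) \<in> borel_measurable (lborel \<Otimes>\<^sub>M lborel)"
    using m by (simp add: lborel_prod)
  have [measurable]: "(\<lambda>x::real^2. \<phi> (x $ 1) * \<psi> (x $ 2)) \<in> borel_measurable borel"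
    by measurable
  have p': "integrable (lborel \<Otimes>\<^sub>M lborel) (\<lambda>(x,y). \<phi> x * \<psi> y)"
  proof (rule lborel_pair.Fubini_integrable)
    show "(\<lambda>(x,y). \<phi> x * \<psi> y) \<in> borel_measurable (lborel \<Otimes>\<^sub>M lborel)" by measurable
    have "integrable lborel (\<lambda>x. norm (\<phi> x) * (LINT y|lborel. norm (\<psi> y)))"
      using \<phi> by simp
    then show "integrable lborel (\<lambda>x. LINT y|lborel. norm (case (x, y) of (x, y) \<Rightarrow> \<phi> x * \<psi> y))"
      by (simp add: norm_mult)
  qed (use \<psi> in simp)
  then have p: "integrable (lborel \<Otimes>\<^sub>M lborel) (\<lambda>p. \<phi> (fst p) * \<psi> (snd p))"
    unfolding case_prod_beta' .
  show "integrable lborel (\<lambda>x::real^2. \<phi> (x $ 1) * \<psi> (x $ 2))"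
    unfolding lborel_vec2 by (subst integrable_distr_eq) (use p in \<open>auto simp: vector_2 case_prod_beta\<close>)
  have "(LINT x::real^2|lborel. \<phi> (x $ 1) * \<psi> (x $ 2)) = (LINT p|(lborel \<Otimes>\<^sub>M lborel). (case p of (x,y) \<Rightarrow> \<phi> x * \<psi> y))"
    unfolding lborel_vec2 by (subst integral_distr) (auto simp: vector_2 case_prod_beta')
  also have "\<dots> = (LINT x|lborel. \<phi> x) * (LINT x|lborel. \<psi> x)"
    using lborel_pair.integral_fst'[OF p'] \<phi> \<psi> by simp
  finally show "(LINT x::real^2|lborel. \<phi> (x $ 1) * \<psi> (x $ 2)) = (LINT x|lborel. \<phi> x) * (LINT x|lborel. \<psi> x)" .
qed

lemma gauss2_nonneg: "0 \<le> gauss2 x"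
  by (simp add: gauss2_def)

lemma gauss2_measurable[measurable]: "gauss2 \<in> borel_measurable borel"
  unfolding gauss2_def[abs_def] by measurable

lemma gauss2_integrable: "integrable lborel gauss2"
  unfolding gauss2_def[abs_def]
  by (rule integrable_vec2_mult) (auto intro: integrable_normal_density)

lemma integral_gauss2: "(LINT x|lborel. gauss2 x) = 1"
  unfolding gauss2_def[abs_def]
  by (subst integral_vec2_mult) (auto intro: integrable_normal_density)

text \<open>The left side is the characteristic function of the standard normal distribution, with
  the density written out.\<close>

lemma fourier_std_normal:
  "(LINT x|lborel. of_real (std_normal_density x) * cis (t * x)) = complex_of_real (exp (- t\<^sup>2 / 2))"
proof -
  have "char std_normal_distribution t = (LINT x|lborel. of_real (std_normal_density x) * cis (t * x))"
    unfolding char_def 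
    by (subst integral_density) (auto simp: scaleR_conv_of_real cis_conv_exp)
  then show ?thesis
    by (simp add: char_std_normal_distribution)
qed

lemma fourier_gauss2:
  fixes y :: "real^2"
  shows "(LINT x|lborel. of_real (gauss2 x) * cis (y \<bullet> x)) = complex_of_real (2 * pi * gauss2 y)"
proof -
  have i: "integrable lborel (\<lambda>x. of_real (std_normal_density x) * cis (t * x))" for t
    by (rule Bochner_Integration.integrable_bound[OF integrable_normal_density[of 1 0]])
       (auto simp: norm_mult)
  have "(LINT x|lborel. of_real (gauss2 x) * cis (y \<bullet> x)) = 
    (LINT x::real^2|lborel. (of_real (std_normal_density (x$1)) * cis (y$1 * x$1)) * (of_real (std_normal_density (x$2)) * cis (y$2 * x$2)))"
    by (intro Bochner_Integration.integral_cong) (auto simp: gauss2_def inner_vec_def sum_2 simp flip: cis_mult)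
  also have "\<dots> = of_real (exp (- (y$1)\<^sup>2 / 2)) * of_real (exp (- (y$2)\<^sup>2 / 2))"
    by (subst integral_vec2_mult[OF i i]) (simp add: fourier_std_normal)
  also have "\<dots> = complex_of_real (2 * pi * gauss2 y)"
    by (simp add: gauss2_def std_normal_density_def field_simps flip: of_real_mult)
  finally show ?thesis .
qed

lemma fourier_gauss2_scaled:
  fixes y :: "real^2"
  assumes "\<epsilon> > 0"
  shows "(LINT x|lborel. of_real (gauss2 (\<epsilon> *\<^sub>R x)) * cis (y \<bullet> x)) =
    complex_of_real (2 * pi / \<epsilon>\<^sup>2 * gauss2 (y /\<^sub>R \<epsilon>))"
proof -
  have "(LINT x|lborel. of_real (gauss2 (\<epsilon> *\<^sub>R x)) * cis (y \<bullet> x)) = 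
     \<bar>inverse \<epsilon>\<bar> ^ DIM(real^2) *\<^sub>R (LINT x|lborel. of_real (gauss2 (\<epsilon> *\<^sub>R (0 + inverse \<epsilon> *\<^sub>R x))) * cis (y \<bullet> (0 + inverse \<epsilon> *\<^sub>R x)))"
    by (rule integral_lborel_affine) (use assms in auto)
  also have "\<dots> = \<bar>inverse \<epsilon>\<bar> ^ 2 *\<^sub>R (LINT x|lborel. of_real (gauss2 x) * cis ((y /\<^sub>R \<epsilon>) \<bullet> x))"
    using assms by simp
  also have "\<dots> = complex_of_real (2 * pi / \<epsilon>\<^sup>2 * gauss2 (y /\<^sub>R \<epsilon>))"
    unfolding fourier_gauss2 using assms by (simp add: scaleR_conv_of_real field_simps)
  finally show ?thesis .
qed


section \<open>A lower Plancherel inequality\<close>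

text \<open>The criterion behind both exchanges of integrals in the Plancherel argument: the
  dominating function separates, so its double integral is a product of two finite ones.\<close>

lemma integrable_lborel_pair_bound:
  fixes F :: "'a::euclidean_space \<Rightarrow> 'b::euclidean_space \<Rightarrow> 'c::{banach, second_countable_topology}"
  assumes [measurable]: "case_prod F \<in> borel_measurable (lborel \<Otimes>\<^sub>M lborel)"
    and p: "integrable lborel p" and q: "integrable lborel q"
    and le: "\<And>x y. norm (F x y) \<le> (p x * q y :: real)"
  shows "integrable (lborel \<Otimes>\<^sub>M lborel) (case_prod F)"
proof (rule Bochner_Integration.integrable_bound)
  have [measurable]: "p \<in> borel_measurable borel" "q \<in> borel_measurable borel"
    using p q by auto
  show "integrable (lborel \<Otimes>\<^sub>M lborel) (\<lambda>(x, y). p x * q y)"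
  proof (rule lborel_pair.Fubini_integrable)
    have "integrable lborel (\<lambda>x. norm (p x) * (LINT y|lborel. norm (q y)))"
      using p by simp
    then show "integrable lborel (\<lambda>x. LINT y|lborel. norm (case (x, y) of (x, y) \<Rightarrow> p x * q y))"
      by (simp add: abs_mult)
  qed (use q in \<open>auto simp: case_prod_beta'\<close>)
  show "AE z in lborel \<Otimes>\<^sub>M lborel. norm (case z of (x, y) \<Rightarrow> F x y) \<le> norm (case z of (x, y) \<Rightarrow> p x * q y)"
    by (rule AE_I2) (auto intro: order_trans[OF le abs_ge_self])
qed fact

text \<open>Insert the Gaussian \<open>gauss2 (\<epsilon> *\<^sub>R \<xi>)\<close> on the Fourier side; by Fubini this convolves \<open>u\<close> with an approximate
  identity, and \<open>\<epsilon> \<longrightarrow> 0\<close>.\<close>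
lemma plancherel_ge:
  fixes u :: "real^2 \<Rightarrow> complex"
  assumes cont: "continuous_on UNIV u" and int: "integrable lborel u"
    and bd: "\<And>x. norm (u x) \<le> M"
  shows "ennreal ((2 * pi)\<^sup>2 * (LINT s|lborel. (norm (u s))\<^sup>2)) \<le>
    (\<integral>\<^sup>+\<xi>. ennreal ((norm (LINT s|lborel. u s * cis (- (\<xi> \<bullet> s))))\<^sup>2) \<partial>lborel)"
proof -
  define U where "U \<xi> = (LINT s|lborel. u s * cis (- (\<xi> \<bullet> s)))" for \<xi>
  define L where "L = (LINT s|lborel. norm (u s))"
  have um[measurable]: "u \<in> borel_measurable borel"
    using int by auto
  have Um[measurable]: "U \<in> borel_measurable borel"
    unfolding U_def[abs_def] by measurable
  have UL: "norm (U \<xi>) \<le> L" for \<xi>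
    unfolding U_def L_def
    by (rule order_trans[OF integral_norm_bound]) (simp add: norm_mult)
  have cint: "integrable lborel (\<lambda>s. u s * cis (t s))" if [measurable]: "t \<in> borel_measurable borel" for t
    by (rule Bochner_Integration.integrable_bound[OF int]) (auto simp: norm_mult)
  have gint: "integrable lborel (\<lambda>\<xi>. gauss2 (\<epsilon> *\<^sub>R \<xi>))" if "\<epsilon> > 0" for \<epsilon>
    using integrable_lborel_affine[OF gauss2_integrable, of \<epsilon> 0] that by simp
  define J where "J \<epsilon> = (LINT \<xi>|lborel. gauss2 (\<epsilon> *\<^sub>R \<xi>) * (norm (U \<xi>))\<^sup>2)" for \<epsilon>
  define V where "V \<epsilon> s = (LINT z|lborel. u (s + \<epsilon> *\<^sub>R z) * of_real (gauss2 z))" for \<epsilon> s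
  have Vm[measurable]: "V \<epsilon> \<in> borel_measurable borel" for \<epsilon>
    unfolding V_def[abs_def] by measurable
  \<comment> \<open>The damped energy of \<open>U\<close> is the pairing of \<open>u\<close> with
    its mollification. First \<open>cnj (U \<xi>)\<close> is unfolded and the integrals are
    exchanged, then the same is done for \<open>U \<xi>\<close>.\<close>
  have J: "complex_of_real (J \<epsilon>) = 2 * pi * (LINT s|lborel. cnj (u s) * V \<epsilon> s)" if \<epsilon>: "\<epsilon> > 0" for \<epsilon>
  proof -
    have "complex_of_real (J \<epsilon>) = (LINT \<xi>|lborel. of_real (gauss2 (\<epsilon> *\<^sub>R \<xi>)) * U \<xi> * cnj (U \<xi>))"
      unfolding J_def integral_complex_of_real[symmetric]
      by (intro Bochner_Integration.integral_cong) (simp_all add: complex_norm_square[symmetric] mult.assoc)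
    also have "\<dots> = (LINT \<xi>|lborel. (LINT s|lborel. of_real (gauss2 (\<epsilon> *\<^sub>R \<xi>)) * U \<xi> * (cnj (u s) * cis (\<xi> \<bullet> s))))"
    proof (intro Bochner_Integration.integral_cong refl)
      fix \<xi>
      have "cnj (U \<xi>) = (LINT s|lborel. cnj (u s) * cis (\<xi> \<bullet> s))"
        unfolding U_def by (subst Bochner_Integration.integral_cnj[symmetric]) (simp add: cis_cnj)
      then show "of_real (gauss2 (\<epsilon> *\<^sub>R \<xi>)) * U \<xi> * cnj (U \<xi>) =
          (LINT s|lborel. of_real (gauss2 (\<epsilon> *\<^sub>R \<xi>)) * U \<xi> * (cnj (u s) * cis (\<xi> \<bullet> s)))"
        by simp
    qed
    \<comment> \<open>Only boundedness of \<open>U\<close> by \<open>L\<close> is known, so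
      integrability in \<open>\<xi>\<close> comes entirely from the Gaussian factor.\<close>
    also have "\<dots> = (LINT s|lborel. (LINT \<xi>|lborel. of_real (gauss2 (\<epsilon> *\<^sub>R \<xi>)) * U \<xi> * (cnj (u s) * cis (\<xi> \<bullet> s))))"
    proof (rule lborel_pair.Fubini_integral[symmetric], rule integrable_lborel_pair_bound)
      show "integrable lborel (\<lambda>\<xi>. gauss2 (\<epsilon> *\<^sub>R \<xi>) * L)"
        using gint[OF \<epsilon>] by simp
      show "integrable lborel (\<lambda>s. norm (u s))" using int by simp
      show "norm (of_real (gauss2 (\<epsilon> *\<^sub>R \<xi>)) * U \<xi> * (cnj (u s) * cis (\<xi> \<bullet> s))) \<le> gauss2 (\<epsilon> *\<^sub>R \<xi>) * L * norm (u s)" for \<xi> s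
        by (auto simp: norm_mult gauss2_nonneg intro!: mult_right_mono mult_left_mono UL)
    qed measurable
    also have "\<dots> = (LINT s|lborel. cnj (u s) * (2 * pi * V \<epsilon> s))"
    proof (intro Bochner_Integration.integral_cong refl)
      fix s
      have "(LINT \<xi>|lborel. of_real (gauss2 (\<epsilon> *\<^sub>R \<xi>)) * U \<xi> * (cnj (u s) * cis (\<xi> \<bullet> s)))
         = (LINT \<xi>|lborel. cnj (u s) * (LINT r|lborel. of_real (gauss2 (\<epsilon> *\<^sub>R \<xi>)) * (u r * cis ((s - r) \<bullet> \<xi>))))"
      proof (intro Bochner_Integration.integral_cong refl)
        fix \<xi>
        have "U \<xi> * cis (\<xi> \<bullet> s) = (LINT r|lborel. u r * cis (- (\<xi> \<bullet> r)) * cis (\<xi> \<bullet> s))"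
          unfolding U_def by simp
        also have "\<dots> = (LINT r|lborel. u r * cis ((s - r) \<bullet> \<xi>))"
          by (intro Bochner_Integration.integral_cong refl)
            (simp add: mult.assoc cis_mult inner_diff_left inner_diff_right inner_commute)
        finally have eq: "U \<xi> * cis (\<xi> \<bullet> s) = (LINT r|lborel. u r * cis ((s - r) \<bullet> \<xi>))" .
        have "of_real (gauss2 (\<epsilon> *\<^sub>R \<xi>)) * U \<xi> * (cnj (u s) * cis (\<xi> \<bullet> s)) =
            cnj (u s) * (of_real (gauss2 (\<epsilon> *\<^sub>R \<xi>)) * (U \<xi> * cis (\<xi> \<bullet> s)))"
          by (simp only: mult_ac)
        then show "of_real (gauss2 (\<epsilon> *\<^sub>R \<xi>)) * U \<xi> * (cnj (u s) * cis (\<xi> \<bullet> s)) =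
            cnj (u s) * (LINT r|lborel. of_real (gauss2 (\<epsilon> *\<^sub>R \<xi>)) * (u r * cis ((s - r) \<bullet> \<xi>)))"
          unfolding eq by simp
      qed
      also have "\<dots> = cnj (u s) * (LINT \<xi>|lborel. (LINT r|lborel. of_real (gauss2 (\<epsilon> *\<^sub>R \<xi>)) * (u r * cis ((s - r) \<bullet> \<xi>))))"
        by simp
      also have "(LINT \<xi>|lborel. (LINT r|lborel. of_real (gauss2 (\<epsilon> *\<^sub>R \<xi>)) * (u r * cis ((s - r) \<bullet> \<xi>)))) =
         (LINT r|lborel. (LINT \<xi>|lborel. of_real (gauss2 (\<epsilon> *\<^sub>R \<xi>)) * (u r * cis ((s - r) \<bullet> \<xi>))))"
      proof (rule lborel_pair.Fubini_integral[symmetric], rule integrable_lborel_pair_bound)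
        show "integrable lborel (\<lambda>\<xi>. gauss2 (\<epsilon> *\<^sub>R \<xi>))"
          using gint[OF \<epsilon>] .
        show "integrable lborel (\<lambda>s. norm (u s))" using int by simp
        show "norm (of_real (gauss2 (\<epsilon> *\<^sub>R \<xi>)) * (u r * cis ((s - r) \<bullet> \<xi>))) \<le> gauss2 (\<epsilon> *\<^sub>R \<xi>) * norm (u r)" for \<xi> r
          by (auto simp: norm_mult gauss2_nonneg)
      qed measurable
      also have "\<dots> = (LINT r|lborel. u r * (LINT \<xi>|lborel. of_real (gauss2 (\<epsilon> *\<^sub>R \<xi>)) * cis ((s - r) \<bullet> \<xi>)))"
        by (simp add: mult.left_commute)
      also have "\<dots> = (LINT r|lborel. u r * complex_of_real (2 * pi / \<epsilon>\<^sup>2 * gauss2 ((s - r) /\<^sub>R \<epsilon>)))"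
        by (simp only: fourier_gauss2_scaled[OF \<epsilon>])
      \<comment> \<open>Substituting r = s + \<epsilon> z produces the Jacobian \<epsilon>^2, which
        cancels the 1 / \<epsilon>^2 in the transform of the dilated Gaussian; the sign of z
        disappears because \<open>gauss2\<close> is even.\<close>
      also have "\<dots> = \<bar>\<epsilon>\<bar> ^ DIM(real^2) *\<^sub>R (LINT z|lborel. u (s + \<epsilon> *\<^sub>R z) * complex_of_real (2 * pi / \<epsilon>\<^sup>2 * gauss2 ((s - (s + \<epsilon> *\<^sub>R z)) /\<^sub>R \<epsilon>)))"
        by (rule integral_lborel_affine) (use \<epsilon> in auto)
      also have "\<dots> = \<epsilon>\<^sup>2 *\<^sub>R (LINT z|lborel. (of_real (2 * pi / \<epsilon>\<^sup>2)) * (u (s + \<epsilon> *\<^sub>R z) * of_real (gauss2 z)))"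
        using \<epsilon> by (simp add: gauss2_def normal_density_def mult_ac)
      also have "\<dots> = 2 * pi * V \<epsilon> s"
        using \<epsilon> unfolding integral_mult_right_zero V_def[symmetric] by (simp add: scaleR_conv_of_real)
      finally show "(LINT \<xi>|lborel. of_real (gauss2 (\<epsilon> *\<^sub>R \<xi>)) * U \<xi> * (cnj (u s) * cis (\<xi> \<bullet> s))) = cnj (u s) * (2 * pi * V \<epsilon> s)" .
    qed
    also have "\<dots> = 2 * pi * (LINT s|lborel. cnj (u s) * V \<epsilon> s)"
    proof -
      have "cnj z * (2 * pi * w) = 2 * pi * (cnj z * w)" for z w :: complex
        by simp
      then show ?thesis
        by (simp only: integral_mult_right_zero)
    qed
    finally show ?thesis .
  qed
  define e where "e n = inverse (real (Suc n))" for n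
  have e0: "e n > 0" for n by (simp add: e_def)
  have elim: "e \<longlonglongrightarrow> 0" unfolding e_def[abs_def] by (rule LIMSEQ_inverse_real_of_nat)
  have V_le: "norm (V \<epsilon> s) \<le> M" for \<epsilon> s
  proof -
    have "norm (V \<epsilon> s) \<le> (LINT z|lborel. M * gauss2 z)"
      unfolding V_def
    proof (rule Bochner_Integration.integral_norm_bound_integral)
      show i: "integrable lborel (\<lambda>z. M * gauss2 z)" using gauss2_integrable by simp
      show le: "norm (u (s + \<epsilon> *\<^sub>R z) * of_real (gauss2 z)) \<le> M * gauss2 z" for z
        by (auto simp: norm_mult gauss2_nonneg intro!: mult_right_mono bd)
      show "integrable lborel (\<lambda>z. u (s + \<epsilon> *\<^sub>R z) * of_real (gauss2 z))"
        by (rule Bochner_Integration.integrable_bound[OF i])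
          (auto simp del: abs_mult norm_mult intro!: AE_I2 order_trans[OF le abs_ge_self])
    qed
    then show ?thesis by (simp add: integral_gauss2)
  qed
  \<comment> \<open>Continuity of \<open>u\<close> gives the pointwise limit of the integrand, and
    its bound \<open>M\<close> gives the dominating function \<open>M * gauss2 z\<close>.\<close>
  have V_lim: "(\<lambda>n. V (e n) s) \<longlonglongrightarrow> u s" for s
  proof -
    have "(\<lambda>n. V (e n) s) \<longlonglongrightarrow> (LINT z|lborel. u s * of_real (gauss2 z))"
      unfolding V_def
    proof (rule integral_dominated_convergence[where w="\<lambda>z. M * gauss2 z"])
      show "integrable lborel (\<lambda>z. M * gauss2 z)" using gauss2_integrable by simp
      show "AE z in lborel. (\<lambda>n. u (s + e n *\<^sub>R z) * of_real (gauss2 z)) \<longlonglongrightarrow> u s * of_real (gauss2 z)"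
      proof (intro AE_I2 tendsto_mult tendsto_const)
        fix z :: "real^2"
        have "(\<lambda>n. s + e n *\<^sub>R z) \<longlonglongrightarrow> s + 0 *\<^sub>R z"
          by (intro tendsto_intros elim)
        then show "(\<lambda>n. u (s + e n *\<^sub>R z)) \<longlonglongrightarrow> u s"
          using cont by (auto simp: continuous_on_eq_continuous_at intro: isCont_tendsto_compose)
      qed
      show "AE z in lborel. norm (u (s + e n *\<^sub>R z) * of_real (gauss2 z)) \<le> M * gauss2 z" for n
        by (auto simp: norm_mult gauss2_nonneg intro!: mult_right_mono bd)
    qed measurable
    then show ?thesis by (simp add: integral_gauss2)
  qed
  have "(\<lambda>n. LINT s|lborel. cnj (u s) * V (e n) s) \<longlonglongrightarrow> (LINT s|lborel. cnj (u s) * u s)"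
  proof (rule integral_dominated_convergence[where w="\<lambda>s. norm (u s) * M"])
    show "AE s in lborel. (\<lambda>n. cnj (u s) * V (e n) s) \<longlonglongrightarrow> cnj (u s) * u s"
      by (intro AE_I2 tendsto_intros V_lim)
    show "AE s in lborel. norm (cnj (u s) * V (e n) s) \<le> norm (u s) * M" for n
      by (auto simp: norm_mult intro!: mult_left_mono V_le)
  qed (use int in auto)
  also have "(LINT s|lborel. cnj (u s) * u s) = complex_of_real (LINT s|lborel. (norm (u s))\<^sup>2)"
    unfolding integral_complex_of_real[symmetric]
  proof (intro Bochner_Integration.integral_cong refl)
    show "cnj (u s) * u s = complex_of_real ((norm (u s))\<^sup>2)" for s
      by (metis complex_norm_square mult.commute)
  qed
  finally have "(\<lambda>n. complex_of_real (J (e n))) \<longlonglongrightarrow> 2 * pi * complex_of_real (LINT s|lborel. (norm (u s))\<^sup>2)"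
    unfolding J[OF e0] by (intro tendsto_intros)
  then have Jlim: "(\<lambda>n. J (e n)) \<longlonglongrightarrow> 2 * pi * (LINT s|lborel. (norm (u s))\<^sup>2)"
    by (simp only: tendsto_of_real_iff flip: of_real_mult)
  \<comment> \<open>The largest value of \<open>gauss2\<close> is 1 / (2 pi), so
    \<open>2 * pi * gauss2\<close> is a cutoff between 0 and 1. This factor and the one in the limit
    of \<open>J\<close> make up the (2 pi)^2 of the conclusion.\<close>
  have J_le: "ennreal (2 * pi * J \<epsilon>) \<le> (\<integral>\<^sup>+\<xi>. ennreal ((norm (U \<xi>))\<^sup>2) \<partial>lborel)" if \<epsilon>: "\<epsilon> > 0" for \<epsilon>
  proof -
    have i: "integrable lborel (\<lambda>\<xi>. gauss2 (\<epsilon> *\<^sub>R \<xi>) * (norm (U \<xi>))\<^sup>2)"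
    proof (rule Bochner_Integration.integrable_bound)
      show "integrable lborel (\<lambda>\<xi>. gauss2 (\<epsilon> *\<^sub>R \<xi>) * L\<^sup>2)" using gint[OF \<epsilon>] by simp
    qed (auto simp: gauss2_nonneg abs_mult intro!: mult_left_mono power_mono UL)
    have "ennreal (2 * pi * J \<epsilon>) = ennreal (LINT \<xi>|lborel. 2 * pi * (gauss2 (\<epsilon> *\<^sub>R \<xi>) * (norm (U \<xi>))\<^sup>2))"
      unfolding J_def by simp
    also have "\<dots> = (\<integral>\<^sup>+\<xi>. ennreal (2 * pi * (gauss2 (\<epsilon> *\<^sub>R \<xi>) * (norm (U \<xi>))\<^sup>2)) \<partial>lborel)"
      using i by (intro nn_integral_eq_integral[symmetric]) (auto simp: gauss2_nonneg)
    also have "\<dots> \<le> (\<integral>\<^sup>+\<xi>. ennreal ((norm (U \<xi>))\<^sup>2) \<partial>lborel)"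
    proof (intro nn_integral_mono ennreal_leI)
      fix \<xi>
      have "2 * pi * gauss2 x \<le> 1" for x
        by (simp add: gauss2_def std_normal_density_def flip: exp_add)
      from mult_right_mono[OF this, of "(norm (U \<xi>))\<^sup>2" "\<epsilon> *\<^sub>R \<xi>"]
      show "2 * pi * (gauss2 (\<epsilon> *\<^sub>R \<xi>) * (norm (U \<xi>))\<^sup>2) \<le> (norm (U \<xi>))\<^sup>2"
        by (simp add: mult.assoc)
    qed
    finally show ?thesis .
  qed
  have "(\<lambda>n. ennreal (2 * pi * J (e n))) \<longlonglongrightarrow> ennreal (2 * pi * (2 * pi * (LINT s|lborel. (norm (u s))\<^sup>2)))"
    by (intro tendsto_ennrealI tendsto_intros Jlim)
  from LIMSEQ_le_const2[OF this] J_le[OF e0]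
  show ?thesis
    unfolding U_def by (simp add: power2_eq_square mult.assoc)
qed


section \<open>Rapidly decreasing functions and directional derivatives\<close>

text \<open>Decay alone, without smoothness, so that a function and its derivative can be treated
  separately. The weight is (1 + |x|)^n because it is multiplicative in n, unlike the weight 1 +
  |x|^n in \<open>schwartz\<close>.\<close>

definition rapid :: "('a::real_normed_vector \<Rightarrow> 'b::real_normed_vector) \<Rightarrow> bool" where
  "rapid u \<longleftrightarrow> (\<forall>n. \<exists>C. \<forall>x. (1 + norm x) ^ n * norm (u x) \<le> C)"

text \<open>A polynomial factor is absorbed by using the decay of \<open>u\<close> of order n + m in
  place of n. The absolute value of \<open>K\<close> appears in the proof since nothing is assumed
  about its sign.\<close>

lemma rapid_dominated:
  assumes u: "rapid u" and le: "\<And>x. norm (v x) \<le> K * (1 + norm x) ^ m * norm (u x)"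
  shows "rapid v"
  unfolding rapid_def
proof
  fix n
  obtain C where C: "\<And>x. (1 + norm x) ^ (n + m) * norm (u x) \<le> C"
    using u unfolding rapid_def by blast
  have "(1 + norm x) ^ n * norm (v x) \<le> \<bar>K\<bar> * C" for x
  proof -
    have "(1 + norm x) ^ n * norm (v x) \<le> (1 + norm x) ^ n * (K * (1 + norm x) ^ m * norm (u x))"
      by (intro mult_left_mono le) simp
    also have "\<dots> = K * ((1 + norm x) ^ (n + m) * norm (u x))"
      by (simp add: power_add)
    also have "\<dots> \<le> \<bar>K\<bar> * ((1 + norm x) ^ (n + m) * norm (u x))"
      by (intro mult_right_mono) auto
    also have "\<dots> \<le> \<bar>K\<bar> * C"
      by (intro mult_left_mono C) simp
    finally show ?thesis .
  qed
  then show "\<exists>C. \<forall>x. (1 + norm x) ^ n * norm (v x) \<le> C" by blast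
qed

lemma rapid_add:
  assumes "rapid u" "rapid v"
  shows "rapid (\<lambda>x. u x + v x)"
  unfolding rapid_def
proof
  fix n
  obtain C D where C: "\<And>x. (1 + norm x) ^ n * norm (u x) \<le> C" and D: "\<And>x. (1 + norm x) ^ n * norm (v x) \<le> D"
    using assms unfolding rapid_def by meson
  have "(1 + norm x) ^ n * norm (u x + v x) \<le> C + D" for x
  proof -
    have "(1 + norm x) ^ n * norm (u x + v x) \<le> (1 + norm x) ^ n * (norm (u x) + norm (v x))"
      by (intro mult_left_mono norm_triangle_ineq) simp
    then show ?thesis using C[of x] D[of x] by (simp add: distrib_left)
  qed
  then show "\<exists>C. \<forall>x. (1 + norm x) ^ n * norm (u x + v x) \<le> C" by blast
qed

lemma rapid_bounded:
  assumes "rapid u"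
  obtains M where "M \<ge> 0" "\<And>x. norm (u x) \<le> M"
proof -
  obtain C where C: "\<And>x. (1 + norm x) ^ 0 * norm (u x) \<le> C"
    using assms unfolding rapid_def by blast
  have "norm (u x) \<le> max 0 C" for x using C[of x] by simp
  then show ?thesis using that[of "max 0 C"] by simp
qed

lemma rapid_affine:
  assumes u: "rapid u" and c: "c \<noteq> 0"
  shows "rapid (\<lambda>x. u (t + c *\<^sub>R x))"
  unfolding rapid_def
proof
  fix n
  obtain C where C: "\<And>x. (1 + norm x) ^ n * norm (u x) \<le> C"
    using u unfolding rapid_def by blast
  \<comment> \<open>From |x| \<le> (|t + c x| + |t|) / |c|, with the numerator at most (1 + |t|) (1
    + |t + c x|).\<close>
  define K where "K = 1 + (1 + norm t) / \<bar>c\<bar>"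
  have K: "1 + norm x \<le> K * (1 + norm (t + c *\<^sub>R x))" for x
  proof -
    have "norm (c *\<^sub>R x) \<le> norm (t + c *\<^sub>R x) + norm t"
      by (metis add_diff_cancel_left' norm_triangle_ineq4)
    also have "\<dots> \<le> (1 + norm t) * (1 + norm (t + c *\<^sub>R x))"
      by (simp add: algebra_simps)
    finally have "norm x \<le> (1 + norm t) / \<bar>c\<bar> * (1 + norm (t + c *\<^sub>R x))"
      using c by (simp add: field_simps)
    then show ?thesis
      unfolding K_def by (simp add: distrib_right) (smt (verit) norm_ge_zero)
  qed
  have K0: "0 \<le> K" unfolding K_def by simp
  have "(1 + norm x) ^ n * norm (u (t + c *\<^sub>R x)) \<le> K ^ n * C" for x
  proof -
    have "(1 + norm x) ^ n * norm (u (t + c *\<^sub>R x)) \<le> (K * (1 + norm (t + c *\<^sub>R x))) ^ n * norm (u (t + c *\<^sub>R x))"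
      by (intro mult_right_mono power_mono K) auto
    also have "\<dots> = K ^ n * ((1 + norm (t + c *\<^sub>R x)) ^ n * norm (u (t + c *\<^sub>R x)))"
      by (simp add: power_mult_distrib)
    also have "\<dots> \<le> K ^ n * C"
      by (intro mult_left_mono C) (simp add: K0)
    finally show ?thesis .
  qed
  then show "\<exists>C. \<forall>x. (1 + norm x) ^ n * norm (u (t + c *\<^sub>R x)) \<le> C" by blast
qed

text \<open>The exponent 4 leaves two powers for each coordinate: (1 + |x|)^4 is at least (1 +
  x_1^2) (1 + x_2^2), and the reciprocal of that product is integrable by separation.\<close>

lemma integrable_decay_weight: "integrable lborel (\<lambda>x::real^2. inverse ((1 + norm x) ^ 4))"
proof (rule Bochner_Integration.integrable_bound)
  have "integrable lborel (\<lambda>x::real. inverse (1 + x\<^sup>2))"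
    using integrable_inverse_1_plus_square by (simp add: set_integrable_def einterval_def)
  then show "integrable lborel (\<lambda>x::real^2. inverse (1 + (x$1)\<^sup>2) * inverse (1 + (x$2)\<^sup>2))"
    by (intro integrable_vec2_mult)
  have "inverse ((1 + norm x) ^ 4) \<le> inverse (1 + (x$1)\<^sup>2) * inverse (1 + (x$2)\<^sup>2)" for x :: "real^2"
  proof -
    have "1 + (x$i)\<^sup>2 \<le> (1 + norm x)\<^sup>2" for i
      using power_mono[OF component_le_norm_cart[of x i], of 2] norm_ge_zero[of x]
      by (simp add: power2_sum add_increasing2)
    then have "(1 + (x$1)\<^sup>2) * (1 + (x$2)\<^sup>2) \<le> (1 + norm x)\<^sup>2 * (1 + norm x)\<^sup>2"
      by (intro mult_mono) auto
    then have "inverse ((1 + norm x)\<^sup>2 * (1 + norm x)\<^sup>2) \<le> inverse ((1 + (x$1)\<^sup>2) * (1 + (x$2)\<^sup>2))"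
      by (intro le_imp_inverse_le) (auto intro!: mult_pos_pos add_pos_nonneg)
    then show ?thesis by (simp add: power_add[symmetric])
  qed
  then show "AE x in lborel. norm (inverse ((1 + norm (x::real^2)) ^ 4)) \<le> norm (inverse (1 + (x$1)\<^sup>2) * inverse (1 + (x$2)\<^sup>2))" 
    by (intro AE_I2) (auto intro: order_trans[OF _ abs_ge_self])
qed measurable

lemma rapid_weight_bound:
  assumes "rapid u"
  obtains C where "C \<ge> 0" "\<And>x. norm (u x) \<le> C * inverse ((1 + norm x) ^ 4)"
proof -
  obtain C where C: "\<And>x. (1 + norm x) ^ 4 * norm (u x) \<le> C"
    using assms unfolding rapid_def by blast
  have "norm (u x) \<le> C * inverse ((1 + norm x) ^ 4)" for x
  proof -
    have "(1 + norm x) ^ 4 > 0" by (intro zero_less_power add_pos_nonneg) simp_all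
    then show ?thesis
      using C[of x] by (simp add: pos_le_divide_eq mult.commute flip: divide_inverse)
  qed
  moreover have "C \<ge> 0" using C[of 0] by simp (smt (verit) norm_ge_zero)
  ultimately show ?thesis using that by blast
qed

lemma rapid_integrable:
  fixes u :: "real^2 \<Rightarrow> 'b::{banach, second_countable_topology}"
  assumes "rapid u" "u \<in> borel_measurable borel"
  shows "integrable lborel u"
proof -
  obtain C where C: "\<And>x. norm (u x) \<le> C * inverse ((1 + norm x) ^ 4)"
    using rapid_weight_bound[OF assms(1)] by blast
  show ?thesis
  proof (rule Bochner_Integration.integrable_bound)
    show "integrable lborel (\<lambda>x::real^2. C * inverse ((1 + norm x) ^ 4))"
      by (intro integrable_mult_right integrable_decay_weight)
    show "AE x in lborel. norm (u x) \<le> norm (C * inverse ((1 + norm x) ^ 4))"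
      by (intro AE_I2) (auto intro: order_trans[OF C abs_ge_self] simp del: abs_mult)
  qed (use assms(2) in simp)
qed

text \<open>Differentiability along the lines in one fixed direction is all that integration by
  parts in one coordinate uses, and it turns the product and chain rules into those for functions of
  one real variable.\<close>

definition has_dir_deriv ::
  "('a::real_normed_vector \<Rightarrow> 'b::real_normed_vector) \<Rightarrow> ('a \<Rightarrow> 'b) \<Rightarrow> 'a \<Rightarrow> bool" where
  "has_dir_deriv u u' e \<longleftrightarrow> (\<forall>x. ((\<lambda>r::real. u (x + r *\<^sub>R e)) has_vector_derivative u' x) (at 0))"

lemma has_dir_deriv_at:
  assumes "has_dir_deriv u u' e"
  shows "((\<lambda>r. u (x + r *\<^sub>R e)) has_vector_derivative u' (x + r *\<^sub>R e)) (at r)"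
proof -
  have *: "((\<lambda>q. u ((x + r *\<^sub>R e) + q *\<^sub>R e)) has_vector_derivative u' (x + r *\<^sub>R e)) (at (r - r))" 
    using assms unfolding has_dir_deriv_def by simp
  have "((\<lambda>q. q - r) has_vector_derivative 1) (at r)"
    by (auto intro!: derivative_eq_intros)
  from vector_diff_chain_at[OF this *]
  show ?thesis by (simp add: o_def algebra_simps)
qed

text \<open>The difference quotients integrate to zero by translation invariance; pass to the limit by dominated
  convergence.\<close>
lemma integral_dir_deriv_eq_0:
  fixes u :: "real^2 \<Rightarrow> 'b::{real_inner, banach, second_countable_topology}"
  assumes d: "has_dir_deriv u u' e" and e: "norm e \<le> 1"
    and u: "rapid u" "u \<in> borel_measurable borel"
    and u': "rapid u'" "u' \<in> borel_measurable borel"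
  shows "(LINT x|lborel. u' x) = 0"
proof -
  define r where "r n = inverse (real (Suc n))" for n
  have r: "r n > 0" "r n \<le> 1" for n by (auto simp: r_def field_simps)
  have rlim: "r \<longlonglongrightarrow> 0" unfolding r_def[abs_def] by (rule LIMSEQ_inverse_real_of_nat)
  define q where "q n x = (u (x + r n *\<^sub>R e) - u x) /\<^sub>R r n" for n x
  obtain C where C0: "C \<ge> 0" and C: "\<And>x. norm (u' x) \<le> C * inverse ((1 + norm x) ^ 4)"
    using rapid_weight_bound[OF u'(1)] by blast
  have [measurable]: "u \<in> borel_measurable borel" "u' \<in> borel_measurable borel" by fact+
  \<comment> \<open>By the mean value inequality the quotient is bounded by \<open>u'\<close> at a
    point \<open>x + y *\<^sub>R e\<close> with 0 < y < r n \<le> 1. Moving x by at most 1 changes 1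
    + |x| by at most a factor 2, hence the constant \<open>2 ^ 4\<close>.\<close>
  have qb: "norm (q n x) \<le> C * 2 ^ 4 * inverse ((1 + norm x) ^ 4)" for n x
  proof -
    have "\<exists>y\<in>{0<..<r n}. norm (u (x + r n *\<^sub>R e) - u (x + 0 *\<^sub>R e)) \<le> norm ((r n - 0) *\<^sub>R u' (x + y *\<^sub>R e))"
    proof (rule mvt_general)
      show "0 < r n" by (rule r)
      show "((\<lambda>r. u (x + r *\<^sub>R e)) has_derivative (\<lambda>q. q *\<^sub>R u' (x + y *\<^sub>R e))) (at y)" for y
        using has_dir_deriv_at[OF d] unfolding has_vector_derivative_def .
      then show "continuous_on {0..r n} (\<lambda>r. u (x + r *\<^sub>R e))"
        by (meson continuous_at_imp_continuous_on has_derivative_continuous)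
    qed
    then obtain y where y: "0 < y" "y < r n" and le: "norm (u (x + r n *\<^sub>R e) - u x) \<le> r n * norm (u' (x + y *\<^sub>R e))"
      using r[of n] by auto
    have "norm (q n x) \<le> norm (u' (x + y *\<^sub>R e))"
    proof -
      have "norm (q n x) = norm (u (x + r n *\<^sub>R e) - u x) / r n"
        using r[of n] by (simp add: q_def divide_inverse mult.commute)
      then show ?thesis
        using le r[of n] by (simp add: pos_divide_le_eq mult.commute)
    qed
    also have "\<dots> \<le> C * inverse ((1 + norm (x + y *\<^sub>R e)) ^ 4)" by (rule C)
    also have "\<dots> \<le> C * (2 ^ 4 * inverse ((1 + norm x) ^ 4))"
    proof (intro mult_left_mono C0)
      have "norm (y *\<^sub>R e) \<le> 1"
        using y r[of n] e mult_mono[of "\<bar>y\<bar>" 1 "norm e" 1] by simp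
      then have "norm x \<le> norm (x + y *\<^sub>R e) + 1"
        using norm_triangle_ineq4[of "x + y *\<^sub>R e" "y *\<^sub>R e"] by simp
      then have "1 + norm x \<le> 1 + (norm (x + y *\<^sub>R e) + 1)"
        by (rule add_left_mono)
      also have "\<dots> \<le> 2 * (1 + norm (x + y *\<^sub>R e))"
        by simp
      finally have "1 + norm x \<le> 2 * (1 + norm (x + y *\<^sub>R e))" .
      then have "(1 + norm x) ^ 4 \<le> 2 ^ 4 * (1 + norm (x + y *\<^sub>R e)) ^ 4"
        by (metis power_mono power_mult_distrib norm_ge_zero add_nonneg_nonneg zero_le_one)
      moreover have "(1 + norm x) ^ 4 > 0"
        by (intro zero_less_power add_pos_nonneg) simp_all
      ultimately have "inverse (2 ^ 4 * (1 + norm (x + y *\<^sub>R e)) ^ 4) \<le> inverse ((1 + norm x) ^ 4)"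
        by (rule le_imp_inverse_le)
      then show "inverse ((1 + norm (x + y *\<^sub>R e)) ^ 4) \<le> 2 ^ 4 * inverse ((1 + norm x) ^ 4)"
        by simp
    qed
    finally show ?thesis by simp
  qed
  have "(\<lambda>n. LINT x|lborel. q n x) \<longlonglongrightarrow> (LINT x|lborel. u' x)"
  proof (rule integral_dominated_convergence[where w="\<lambda>x. C * 2 ^ 4 * inverse ((1 + norm x) ^ 4)"])
    show "integrable lborel (\<lambda>x::real^2. C * 2 ^ 4 * inverse ((1 + norm x) ^ 4))"
      by (intro integrable_mult_right integrable_decay_weight)
    show "AE x in lborel. (\<lambda>n. q n x) \<longlonglongrightarrow> u' x"
    proof (rule AE_I2)
      fix x
      have "((\<lambda>h. (u (x + h *\<^sub>R e) - u x) /\<^sub>R h) \<longlongrightarrow> u' x) (at 0)"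
      proof -
        have "((\<lambda>h. norm (u (x + h *\<^sub>R e) - u x - h *\<^sub>R u' x) / norm h) \<longlongrightarrow> 0) (at 0)"
          using d[unfolded has_dir_deriv_def, rule_format, of x]
          unfolding has_vector_derivative_def has_derivative_at by simp
        then have "((\<lambda>h. norm ((u (x + h *\<^sub>R e) - u x) /\<^sub>R h - u' x)) \<longlongrightarrow> 0) (at 0)"
        proof (rule Lim_transform_eventually)
          show "\<forall>\<^sub>F h in at 0. norm (u (x + h *\<^sub>R e) - u x - h *\<^sub>R u' x) / norm h =
              norm ((u (x + h *\<^sub>R e) - u x) /\<^sub>R h - u' x)"
          proof (rule eventually_at_filter[THEN iffD2], rule always_eventually, intro allI impI)
            fix h :: real
            assume h: "h \<noteq> 0"
            have "(u (x + h *\<^sub>R e) - u x) /\<^sub>R h - u' x = (u (x + h *\<^sub>R e) - u x - h *\<^sub>R u' x) /\<^sub>R h"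
              using h by (simp add: scaleR_diff_right)
            then show "norm (u (x + h *\<^sub>R e) - u x - h *\<^sub>R u' x) / norm h =
                norm ((u (x + h *\<^sub>R e) - u x) /\<^sub>R h - u' x)"
              by (simp add: divide_inverse mult.commute)
          qed
        qed
        then show ?thesis
          by (simp add: Lim_null[of _ "u' x"] tendsto_norm_zero_iff)
      qed
      moreover have "filterlim r (at 0) sequentially"
        using rlim r(1) by (auto simp: filterlim_at less_imp_neq[symmetric] intro!: always_eventually)
      ultimately show "(\<lambda>n. q n x) \<longlonglongrightarrow> u' x"
        unfolding q_def by (rule filterlim_compose)
    qed
    show "AE x in lborel. norm (q n x) \<le> C * 2 ^ 4 * inverse ((1 + norm x) ^ 4)" for n
      using qb by simp
    show "q n \<in> borel_measurable lborel" for n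
      unfolding q_def[abs_def] by measurable
  qed simp
  moreover have "(LINT x|lborel. q n x) = 0" for n
  proof -
    have i: "integrable lborel u" by (rule rapid_integrable[OF u])
    have "(LINT x|lborel. u (x + r n *\<^sub>R e)) = (LINT x|lborel. u x)"
      using integral_lborel_affine[OF u(2), of 1 "r n *\<^sub>R e"] by (simp add: add.commute)
    moreover have "integrable lborel (\<lambda>x. u (x + r n *\<^sub>R e))"
      using integrable_lborel_affine[OF i, of 1 "r n *\<^sub>R e"] by (simp add: add.commute)
    ultimately show ?thesis
      unfolding q_def using i by simp
  qed
  ultimately show ?thesis
    by (simp add: LIMSEQ_const_iff)
qed

section \<open>Product and chain rules along a direction; Fourier integrals of derivatives\<close>

lemma has_dir_deriv_bounded_linear:
  assumes "bounded_linear L" "has_dir_deriv u u' e"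
  shows "has_dir_deriv (\<lambda>x. L (u x)) (\<lambda>x. L (u' x)) e"
  using assms unfolding has_dir_deriv_def
  by (auto intro: bounded_linear.has_vector_derivative)

text \<open>Stated for an arbitrary bilinear map so that it serves scalar and complex products,
  inner products and the quaternion product; the order of the factors is kept for the sake of the
  last.\<close>

lemma has_dir_deriv_bilinear:
  assumes B: "bounded_bilinear B" and u: "has_dir_deriv u u' e" and v: "has_dir_deriv v v' e"
  shows "has_dir_deriv (\<lambda>x. B (u x) (v x)) (\<lambda>x. B (u x) (v' x) + B (u' x) (v x)) e"
  unfolding has_dir_deriv_def
proof
  fix x
  show "((\<lambda>r. B (u (x + r *\<^sub>R e)) (v (x + r *\<^sub>R e))) has_vector_derivative B (u x) (v' x) + B (u' x) (v x)) (at 0)"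
    using bounded_bilinear.has_vector_derivative[OF B u[unfolded has_dir_deriv_def, rule_format, of x]
      v[unfolded has_dir_deriv_def, rule_format, of x]] by simp
qed

lemma has_dir_deriv_cis:
  assumes "has_dir_deriv \<phi> \<phi>' e"
  shows "has_dir_deriv (\<lambda>x. cis (\<phi> x)) (\<lambda>x. \<i> * of_real (\<phi>' x) * cis (\<phi> x)) e"
  unfolding has_dir_deriv_def
proof
  fix x
  have 1: "((\<lambda>r. \<phi> (x + r *\<^sub>R e)) has_vector_derivative \<phi>' x) (at 0)"
    using assms unfolding has_dir_deriv_def by blast
  have "(cis has_vector_derivative \<i> * cis (\<phi> (x + 0 *\<^sub>R e))) (at (\<phi> (x + 0 *\<^sub>R e)))"
    unfolding has_vector_derivative_def
    by (rule has_derivative_eq_rhs, rule has_derivative_cis, rule has_derivative_ident) 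
       (auto simp: fun_eq_iff scaleR_conv_of_real)
  from vector_diff_chain_at[OF 1 this]
  show "((\<lambda>r. cis (\<phi> (x + r *\<^sub>R e))) has_vector_derivative \<i> * of_real (\<phi>' x) * cis (\<phi> x)) (at 0)"
    by (simp add: o_def scaleR_conv_of_real mult_ac)
qed

lemma has_dir_deriv_coord: "has_dir_deriv (\<lambda>x::real^'n. x $ i) (\<lambda>_. axis k 1 $ i) (axis k 1)"
  unfolding has_dir_deriv_def
  by (auto intro!: derivative_eq_intros simp: has_real_derivative_iff_has_vector_derivative[symmetric])

text \<open>Integration by parts: the derivative of \<open>u s * cis (- (\<xi> \<bullet> s))\<close>
  along \<open>e\<close> has integral zero.\<close>

lemma fourier_dir_deriv:
  fixes u u' :: "real^2 \<Rightarrow> complex"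
  assumes d: "has_dir_deriv u u' e" and e: "norm e \<le> 1"
    and u: "rapid u" "u \<in> borel_measurable borel"
    and u': "rapid u'" "u' \<in> borel_measurable borel"
  shows "(LINT s|lborel. u' s * cis (- (\<xi> \<bullet> s))) = \<i> * of_real (\<xi> \<bullet> e) * (LINT s|lborel. u s * cis (- (\<xi> \<bullet> s)))"
proof -
  have [measurable]: "u \<in> borel_measurable borel" "u' \<in> borel_measurable borel" by fact+
  \<comment> \<open>The part of the product rule in which the exponential is differentiated.\<close>
  define w where "w s = u s * (- \<i> * of_real (\<xi> \<bullet> e) * cis (- (\<xi> \<bullet> s)))" for s
  have "has_dir_deriv (\<lambda>s. - (\<xi> \<bullet> s)) (\<lambda>_. - (\<xi> \<bullet> e)) e"
    unfolding has_dir_deriv_def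
    by (auto intro!: derivative_eq_intros
        simp: inner_add_right has_real_derivative_iff_has_vector_derivative[symmetric])
  from has_dir_deriv_bilinear[OF bounded_bilinear_mult d has_dir_deriv_cis[OF this]]
  have D: "has_dir_deriv (\<lambda>s. u s * cis (- (\<xi> \<bullet> s))) (\<lambda>s. w s + u' s * cis (- (\<xi> \<bullet> s))) e"
    by (simp add: w_def)
  have rw: "rapid w"
    by (rule rapid_dominated[OF u(1), of _ "\<bar>\<xi> \<bullet> e\<bar>" 0]) (simp add: w_def norm_mult)
  have ru': "rapid (\<lambda>s. u' s * cis (- (\<xi> \<bullet> s)))"
    by (rule rapid_dominated[OF u'(1), of _ 1 0]) (simp add: norm_mult)
  have [measurable]: "w \<in> borel_measurable borel"
    unfolding w_def[abs_def] by measurable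
  have "(LINT s|lborel. w s + u' s * cis (- (\<xi> \<bullet> s))) = 0"
  proof (rule integral_dir_deriv_eq_0[OF D e])
    show "rapid (\<lambda>s. u s * cis (- (\<xi> \<bullet> s)))"
      by (rule rapid_dominated[OF u(1), of _ 1 0]) (simp add: norm_mult)
  qed (auto intro: rapid_add rw ru')
  moreover have "(LINT s|lborel. w s + u' s * cis (- (\<xi> \<bullet> s))) = (LINT s|lborel. w s) + (LINT s|lborel. u' s * cis (- (\<xi> \<bullet> s)))"
    by (intro Bochner_Integration.integral_add rapid_integrable rw ru') measurable
  moreover have "(LINT s|lborel. w s) = - \<i> * of_real (\<xi> \<bullet> e) * (LINT s|lborel. u s * cis (- (\<xi> \<bullet> s)))"
    unfolding w_def integral_mult_right_zero[symmetric] by (simp only: mult_ac)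
  ultimately show ?thesis
    by (simp add: add_eq_0_iff)
qed

text \<open>The part of the exponents of the two kernels that depends on s but not on the frequency:
  \<open>p\<close> carries a_l / (2 b_l), and \<open>q\<close> carries the offset \<tau>_l /
  b_l.\<close>

definition chirp :: "real^2 \<Rightarrow> real^2 \<Rightarrow> real^2 \<Rightarrow> real" where
  "chirp p q s = (\<Sum>i\<in>UNIV. p $ i * (s $ i)\<^sup>2 + q $ i * s $ i)"

lemma has_dir_deriv_chirp: "has_dir_deriv (chirp p q) (\<lambda>s. 2 * p $ k * s $ k + q $ k) (axis k 1)"
  unfolding has_dir_deriv_def chirp_def has_real_derivative_iff_has_vector_derivative[symmetric]
  using exhaust_2[of k]
  by (auto intro!: derivative_eq_intros simp: sum_2 axis_def)

lemma integrable_rapid_norm_square: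
  fixes v :: "real^2 \<Rightarrow> 'c::{banach, second_countable_topology}"
  assumes "rapid v" and [measurable]: "v \<in> borel_measurable borel"
  shows "integrable lborel (\<lambda>s. (norm (v s))\<^sup>2)"
proof (rule rapid_integrable)
  obtain N where N: "\<And>s. norm (v s) \<le> N" using rapid_bounded[OF assms(1)] by blast
  show "rapid (\<lambda>s. (norm (v s))\<^sup>2)"
    by (rule rapid_dominated[OF assms(1), of _ N 0]) (simp add: power2_eq_square mult_right_mono N)
qed measurable

text \<open>Since \<open>h\<close> is real, the derivative of the chirp only enlarges the modulus of the derivative of
  \<open>h * cis (chirp p q)\<close>.\<close>
lemma chirp_plancherel:
  fixes h h' :: "real^2 \<Rightarrow> real" and p q \<beta> :: "real^2"
  assumes d: "has_dir_deriv h h' (axis k 1)"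
    and h: "rapid h" "continuous_on UNIV h"
    and h': "rapid h'" "continuous_on UNIV h'"
    and \<beta>: "\<And>i. \<beta> $ i \<noteq> 0"
  shows "ennreal ((2 * pi)\<^sup>2 * (LINT s|lborel. (h' s)\<^sup>2)) \<le>
    ennreal \<bar>\<beta> $ 1 * \<beta> $ 2\<bar> * (\<integral>\<^sup>+\<xi>. ennreal ((\<beta> $ k * \<xi> $ k)\<^sup>2 *
      (norm (LINT s|lborel. of_real (h s) * cis (chirp p q s - (\<Sum>i\<in>UNIV. \<beta> $ i * \<xi> $ i * s $ i))))\<^sup>2) \<partial>lborel)"
proof -
  define \<theta>' where "\<theta>' s = 2 * p $ k * s $ k + q $ k" for s :: "real^2"
  define u where "u s = of_real (h s) * cis (chirp p q s)" for s
  define u' where "u' s = of_real (h s) * (\<i> * of_real (\<theta>' s) * cis (chirp p q s)) + of_real (h' s) * cis (chirp p q s)" for s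
  define U where "U \<xi> = (LINT s|lborel. u s * cis (- (\<xi> \<bullet> s)))" for \<xi>
  have cc: "continuous_on UNIV (chirp p q)"
    unfolding chirp_def[abs_def] by (intro continuous_intros)
  have cu: "continuous_on UNIV u" 
    unfolding u_def[abs_def] by (intro continuous_intros continuous_on_cis h(2) cc)
  have cu': "continuous_on UNIV u'"
    unfolding u'_def[abs_def] \<theta>'_def[abs_def] by (intro continuous_intros continuous_on_cis h(2) h'(2) cc)
  have [measurable]: "u \<in> borel_measurable borel" "u' \<in> borel_measurable borel"
    "h' \<in> borel_measurable borel"
    using cu cu' h'(2) by (auto intro: borel_measurable_continuous_onI)
  have Um[measurable]: "U \<in> borel_measurable borel"
    unfolding U_def[abs_def] by measurable
  have du: "has_dir_deriv u u' (axis k 1)"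
    using has_dir_deriv_bilinear[OF bounded_bilinear_mult
        has_dir_deriv_bounded_linear[OF bounded_linear_of_real d] has_dir_deriv_cis[OF has_dir_deriv_chirp[of p q k]]]
    unfolding u_def[abs_def] u'_def[abs_def] \<theta>'_def .
  have ru: "rapid u"
    by (rule rapid_dominated[OF h(1), of _ 1 0]) (simp add: u_def norm_mult)
  have ru': "rapid u'"
    unfolding u'_def[abs_def]
  proof (rule rapid_add)
    show "rapid (\<lambda>s. of_real (h' s) * cis (chirp p q s))"
      by (rule rapid_dominated[OF h'(1), of _ 1 0]) (simp add: norm_mult)
    have "\<bar>\<theta>' s\<bar> \<le> (2 * \<bar>p $ k\<bar> + \<bar>q $ k\<bar>) * (1 + norm s)" for s
    proof -
      have "\<bar>\<theta>' s\<bar> \<le> 2 * \<bar>p $ k\<bar> * \<bar>s $ k\<bar> + \<bar>q $ k\<bar>"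
        unfolding \<theta>'_def by (rule order_trans[OF abs_triangle_ineq]) (simp add: abs_mult)
      also have "\<dots> \<le> 2 * \<bar>p $ k\<bar> * norm s + \<bar>q $ k\<bar>"
        by (intro add_right_mono mult_left_mono component_le_norm_cart) simp
      also have "\<dots> \<le> (2 * \<bar>p $ k\<bar> + \<bar>q $ k\<bar>) * (1 + norm s)"
        by (simp add: algebra_simps)
      finally show ?thesis .
    qed
    then show "rapid (\<lambda>s. complex_of_real (h s) * (\<i> * of_real (\<theta>' s) * cis (chirp p q s)))"
      by (intro rapid_dominated[OF h(1), of _ "2 * \<bar>p $ k\<bar> + \<bar>q $ k\<bar>" 1])
        (simp add: norm_mult mult.commute[of "\<bar>h _\<bar>"] mult_right_mono)
  qed
  \<comment> \<open>Relative to the unimodular chirp, \<open>h' s\<close> is the real part and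
    \<open>\<theta>' s * h s\<close> the imaginary part, so the squares add without a cross term;
    the first square is discarded in the estimate below.\<close>
  have nu': "(norm (u' s))\<^sup>2 = (\<theta>' s * h s)\<^sup>2 + (h' s)\<^sup>2" for s
  proof -
    have "u' s = Complex (h' s) (\<theta>' s * h s) * cis (chirp p q s)"
      by (simp add: u'_def complex_eq_iff algebra_simps)
    then show ?thesis
      by (simp add: norm_mult cmod_power2)
  qed
  obtain M where M: "\<And>s. norm (u' s) \<le> M" using rapid_bounded[OF ru'] by blast
  have "ennreal ((2 * pi)\<^sup>2 * (LINT s|lborel. (h' s)\<^sup>2)) \<le> ennreal ((2 * pi)\<^sup>2 * (LINT s|lborel. (norm (u' s))\<^sup>2))"
  proof (intro ennreal_leI mult_left_mono integral_mono)
    show "integrable lborel (\<lambda>s. (norm (u' s))\<^sup>2)" by (rule integrable_rapid_norm_square[OF ru']) measurable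
    show "integrable lborel (\<lambda>s. (h' s)\<^sup>2)" using integrable_rapid_norm_square[OF h'(1)] by simp
  qed (simp_all add: nu')
  also have "\<dots> \<le> (\<integral>\<^sup>+\<xi>. ennreal ((norm (LINT s|lborel. u' s * cis (- (\<xi> \<bullet> s))))\<^sup>2) \<partial>lborel)"
    by (rule plancherel_ge[OF cu' _ M]) (intro rapid_integrable ru', measurable)
  also have "\<dots> = (\<integral>\<^sup>+\<xi>. ennreal ((\<xi> $ k)\<^sup>2 * (norm (U \<xi>))\<^sup>2) \<partial>lborel)"
  proof (intro nn_integral_cong)
    fix \<xi> :: "real^2"
    have "(LINT s|lborel. u' s * cis (- (\<xi> \<bullet> s))) = \<i> * of_real (\<xi> \<bullet> axis k 1) * U \<xi>"
      unfolding U_def by (rule fourier_dir_deriv[OF du _ ru _ ru']) simp_all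
    then show "ennreal ((norm (LINT s|lborel. u' s * cis (- (\<xi> \<bullet> s))))\<^sup>2) = ennreal ((\<xi> $ k)\<^sup>2 * (norm (U \<xi>))\<^sup>2)"
      by (simp add: norm_mult power_mult_distrib inner_axis)
  qed
  \<comment> \<open>Change of the frequency variable to (\<beta>_i \<xi>_i), in the form in which it
    occurs in the kernels.\<close>
  also have "\<dots> = ennreal (\<Prod>i\<in>UNIV. \<bar>\<beta> $ i\<bar>) * (\<integral>\<^sup>+\<xi>. ennreal (((\<chi> i. \<beta> $ i * \<xi> $ i) $ k)\<^sup>2 * (norm (U (\<chi> i. \<beta> $ i * \<xi> $ i)))\<^sup>2) \<partial>lborel)"
    by (rule nn_integral_lborel_scale_coords[OF _ \<beta>]) measurable
  finally have main: "ennreal ((2 * pi)\<^sup>2 * (LINT s|lborel. (h' s)\<^sup>2)) \<le> ennreal (\<Prod>i\<in>UNIV. \<bar>\<beta> $ i\<bar>) *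
    (\<integral>\<^sup>+\<xi>. ennreal (((\<chi> i. \<beta> $ i * \<xi> $ i) $ k)\<^sup>2 * (norm (U (\<chi> i. \<beta> $ i * \<xi> $ i)))\<^sup>2) \<partial>lborel)" .
  have U: "U (\<chi> i. \<beta> $ i * \<xi> $ i) = (LINT s|lborel. of_real (h s) * cis (chirp p q s - (\<Sum>i\<in>UNIV. \<beta> $ i * \<xi> $ i * s $ i)))" for \<xi>
    unfolding U_def u_def
    by (intro Bochner_Integration.integral_cong refl) (simp add: mult.assoc cis_mult inner_vec_def)
  have "(\<Prod>i\<in>UNIV. \<bar>\<beta> $ i\<bar>) = \<bar>\<beta> $ 1 * \<beta> $ 2\<bar>"
    by (simp add: UNIV_2 abs_mult)
  with main show ?thesis
    unfolding U by simp
qed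

section \<open>The uncertainty inequality for a single function of s\<close>

lemma rapid_coord:
  fixes u :: "real^'n \<Rightarrow> 'b::real_normed_vector"
  assumes "rapid u"
  shows "rapid (\<lambda>s. (s $ k) *\<^sub>R u s)"
proof (rule rapid_dominated[OF assms, of _ 1 1])
  fix s :: "real^'n"
  have "\<bar>s $ k\<bar> \<le> 1 + norm s" using component_le_norm_cart[of s k] by simp
  then show "norm ((s $ k) *\<^sub>R u s) \<le> 1 * (1 + norm s) ^ 1 * norm (u s)"
    by (simp add: mult_right_mono)
qed

text \<open>Expand \<open>0 \<le> (norm (r *\<^sub>R s $ k *\<^sub>R H s + H' s))\<^sup>2\<close> and integrate by parts.\<close>
lemma weighted_uncertainty:
  fixes H H' :: "real^2 \<Rightarrow> 'b::{real_inner, banach, second_countable_topology}"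
  assumes d: "has_dir_deriv H H' (axis k 1)"
    and H: "rapid H" and Hm[measurable]: "H \<in> borel_measurable borel"
    and H': "rapid H'" and H'm[measurable]: "H' \<in> borel_measurable borel"
  shows "r * (LINT s|lborel. (norm (H s))\<^sup>2) \<le>
     r\<^sup>2 * (LINT s|lborel. (norm ((s $ k) *\<^sub>R H s))\<^sup>2) + (LINT s|lborel. (norm (H' s))\<^sup>2)"
proof -
  \<comment> \<open>The derivative of s_k |H|^2 in direction k. That its integral vanishes is the
    integration by parts that trades the cross term for -|H|^2.\<close>
  define \<psi>' where "\<psi>' s = s $ k * (2 * (H s \<bullet> H' s)) + (norm (H s))\<^sup>2" for s
  obtain N where N: "\<And>s. norm (H s) \<le> N" using rapid_bounded[OF H] by blast
  obtain N' where N': "\<And>s. norm (H' s) \<le> N'" using rapid_bounded[OF H'] by blast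
  have sqH: "rapid (\<lambda>s. (norm (H s))\<^sup>2)"
    by (rule rapid_dominated[OF H, of _ N 0]) (simp add: power2_eq_square mult_right_mono N)
  have rip: "rapid (\<lambda>s. 2 * (H s \<bullet> H' s))"
  proof (rule rapid_dominated[OF H, of _ "2 * N'" 0])
    fix s
    have "\<bar>H s \<bullet> H' s\<bar> \<le> norm (H s) * norm (H' s)" by (rule Cauchy_Schwarz_ineq2)
    also have "\<dots> \<le> norm (H s) * N'" by (intro mult_left_mono N') simp
    finally show "norm (2 * (H s \<bullet> H' s)) \<le> 2 * N' * (1 + norm s) ^ 0 * norm (H s)"
      by (simp add: abs_mult mult_ac)
  qed
  have "has_dir_deriv (\<lambda>s. H s \<bullet> H s) (\<lambda>s. 2 * (H s \<bullet> H' s)) (axis k 1)"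
    using has_dir_deriv_bilinear[OF bounded_bilinear_inner d d] by (simp add: inner_commute)
  from has_dir_deriv_bilinear[OF bounded_bilinear_mult has_dir_deriv_coord[of k k] this]
  have D: "has_dir_deriv (\<lambda>s. s $ k * (norm (H s))\<^sup>2) \<psi>' (axis k 1)"
    by (simp add: \<psi>'_def[abs_def] power2_norm_eq_inner)
  have r1: "rapid (\<lambda>s. s $ k * (2 * (H s \<bullet> H' s)))"
    using rapid_coord[OF rip] by simp
  have r\<psi>: "rapid \<psi>'"
    unfolding \<psi>'_def[abs_def] by (intro rapid_add r1 sqH)
  have m[measurable]: "\<psi>' \<in> borel_measurable borel"
    unfolding \<psi>'_def[abs_def] by measurable
  have z: "(LINT s|lborel. \<psi>' s) = 0"
  proof (rule integral_dir_deriv_eq_0[OF D _ _ _ r\<psi> m])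
    show "rapid (\<lambda>s. s $ k * (norm (H s))\<^sup>2)" using rapid_coord[OF sqH] by simp
  qed (simp, measurable)
  have i1: "integrable lborel (\<lambda>s. (norm (H s))\<^sup>2)" by (rule integrable_rapid_norm_square[OF H Hm])
  have i2: "integrable lborel (\<lambda>s. (norm (H' s))\<^sup>2)" by (rule integrable_rapid_norm_square[OF H' H'm])
  have i3: "integrable lborel (\<lambda>s. (norm ((s $ k) *\<^sub>R H s))\<^sup>2)"
    by (rule integrable_rapid_norm_square[OF rapid_coord[OF H]]) measurable
  have i4: "integrable lborel \<psi>'" by (rule rapid_integrable[OF r\<psi> m])
  \<comment> \<open>The integrand is |r s_k H + H'|^2, with its cross term 2 r s_k (H \<bullet> H')
    written as \<open>r * \<psi>' s - r * (norm (H s))\<^sup>2\<close>.\<close>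
  have "0 \<le> (LINT s|lborel. r\<^sup>2 * (norm ((s $ k) *\<^sub>R H s))\<^sup>2 + (norm (H' s))\<^sup>2 + (r * \<psi>' s - r * (norm (H s))\<^sup>2))"
  proof (rule Bochner_Integration.integral_nonneg)
    fix s
    have "(norm ((r * s $ k) *\<^sub>R H s + H' s))\<^sup>2 =
        r\<^sup>2 * (norm ((s $ k) *\<^sub>R H s))\<^sup>2 + (norm (H' s))\<^sup>2 + (r * \<psi>' s - r * (norm (H s))\<^sup>2)"
      unfolding power2_norm_eq_inner \<psi>'_def
      by (simp add: inner_add_left inner_add_right inner_commute algebra_simps power2_eq_square)
    then show "0 \<le> r\<^sup>2 * (norm ((s $ k) *\<^sub>R H s))\<^sup>2 + (norm (H' s))\<^sup>2 + (r * \<psi>' s - r * (norm (H s))\<^sup>2)"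
      by (metis zero_le_power2)
  qed
  also have "\<dots> = r\<^sup>2 * (LINT s|lborel. (norm ((s $ k) *\<^sub>R H s))\<^sup>2) + (LINT s|lborel. (norm (H' s))\<^sup>2)
      + (r * (LINT s|lborel. \<psi>' s) - r * (LINT s|lborel. (norm (H s))\<^sup>2))"
    using i1 i2 i3 i4 by (simp del: norm_scaleR)
  finally show ?thesis unfolding z by simp
qed


section \<open>The transform of a real function\<close>

text \<open>Entries of the Gram matrix of 1, \<open>\<nu>\<close>, \<open>\<mu>\<close>,
  \<open>\<nu> * \<mu>\<close>. These four need not be independent, since \<open>\<mu>\<close> may
  equal \<open>\<nu>\<close> or its negative. All identities follow from both real parts being zero
  and both norms being one.\<close>

lemma inner_pure_units:
  assumes "pure_unit \<nu>" "pure_unit \<mu>"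
  shows "1 \<bullet> \<nu> = 0" "\<nu> \<bullet> 1 = 0" "\<nu> \<bullet> \<nu> = 1" "1 \<bullet> (\<nu> * \<mu>) = - (\<nu> \<bullet> \<mu>)" "(\<nu> * \<mu>) \<bullet> 1 = - (\<nu> \<bullet> \<mu>)"
    "\<nu> \<bullet> (\<nu> * \<mu>) = 0" "(\<nu> * \<mu>) \<bullet> \<nu> = 0" "\<mu> \<bullet> (\<nu> * \<mu>) = 0" "(\<nu> * \<mu>) \<bullet> \<mu> = 0" "(\<nu> * \<mu>) \<bullet> (\<nu> * \<mu>) = 1"
proof -
  note z = pure_unit_norm[OF assms(1)] pure_unit_norm[OF assms(2)]
  show "\<nu> \<bullet> \<nu> = 1" "(\<nu> * \<mu>) \<bullet> (\<nu> * \<mu>) = 1"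
    using z by (simp_all add: norm_mult flip: power2_norm_eq_inner)
qed (simp_all add: inner_quat_def quat_times_sel pure_unit_norm[OF assms(1)] pure_unit_norm[OF assms(2)] algebra_simps)

text \<open>Applied to the four real cosine and sine integrals of a two-sided transform of a real function, the
  brackets on the right are the squared moduli of two complex Fourier integrals.\<close>
lemma norm_square_pure_units_combination:
  assumes "pure_unit \<nu>" "pure_unit \<mu>"
  shows "(norm (x *\<^sub>R 1 + y *\<^sub>R \<nu> + z *\<^sub>R \<mu> + w *\<^sub>R (\<nu> * \<mu>)))\<^sup>2 =
    (1 + \<nu> \<bullet> \<mu>) / 2 * ((x - w)\<^sup>2 + (y + z)\<^sup>2) + (1 - \<nu> \<bullet> \<mu>) / 2 * ((x + w)\<^sup>2 + (y - z)\<^sup>2)"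
  \<comment> \<open>Both sides equal x^2 + y^2 + z^2 + w^2 + 2
    (\<open>\<nu> \<bullet> \<mu>\<close>) (y z - x w).\<close>
  unfolding power2_norm_eq_inner
  using inner_quat_def[of 1 1] inner_pure_units[OF assms] inner_pure_units[OF assms(2,2)]
  by (simp add: inner_add_left inner_add_right inner_commute[of \<mu> \<nu>] field_simps power2_eq_square)

lemma qexp_add:
  assumes "pure_unit \<nu>"
  shows "qexp \<nu> (x + y) = qexp \<nu> x * qexp \<nu> y"
  unfolding qexp_eq qembed_mult[OF assms, symmetric] cis_mult ..

text \<open>The factors of the kernel that do not depend on \<open>s\<close> only contribute their modulus; they are omitted here.\<close>
definition olct_fourier :: "real \<Rightarrow> (real^2 \<Rightarrow> real) \<Rightarrow> (2 \<Rightarrow> real) \<Rightarrow> (2 \<Rightarrow> real) \<Rightarrow> (2 \<Rightarrow> real) \<Rightarrow> real^2 \<Rightarrow> complex" where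
  "olct_fourier \<sigma> h a b \<tau> \<xi> =
     (LINT s|lborel. of_real (h s) *
       cis (chirp (vector [a 1 / (2 * b 1), \<sigma> * (a 2 / (2 * b 2))]) (vector [\<tau> 1 / b 1, \<sigma> * (\<tau> 2 / b 2)]) s
         - (\<Sum>i\<in>UNIV. vector [1 / b 1, \<sigma> / b 2] $ i * \<xi> $ i * s $ i)))"

text \<open>The factors of the kernels that are free of s can be moved to the two outer ends of the
  product and contribute only their norms. What is left is exp(\<nu> \<alpha>_1) h exp(\<mu>
  \<alpha>_2) with real h, which expands into four real cosine and sine integrals. The cases
  \<sigma> = 1 and \<sigma> = -1 are the complex integrals with phases \<alpha>_1 + \<alpha>_2 and
  \<alpha>_1 - \<alpha>_2.\<close>

lemma norm_qolct_real:
  fixes a b c d \<tau> \<eta> :: "2 \<Rightarrow> real" and h :: "real^2 \<Rightarrow> real"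
  assumes \<nu>: "pure_unit \<nu>" and \<mu>: "pure_unit \<mu>"
    and A: "\<And>l. A l = (a l, b l, c l, d l, \<tau> l, \<eta> l)" and b: "\<And>l. b l \<noteq> 0"
    and h: "integrable lborel h"
  shows "(norm (qolct \<nu> \<mu> (A 1) (A 2) (\<lambda>s. of_real (h s)) \<xi>))\<^sup>2 =
    1 / ((2 * pi)\<^sup>2 * \<bar>b 1 * b 2\<bar>) *
      ((1 + \<nu> \<bullet> \<mu>) / 2 * (norm (olct_fourier 1 h a b \<tau> \<xi>))\<^sup>2 + (1 - \<nu> \<bullet> \<mu>) / 2 * (norm (olct_fourier (-1) h a b \<tau> \<xi>))\<^sup>2)"
proof -
  have [measurable]: "h \<in> borel_measurable borel" using h by auto
  \<comment> \<open>The exponent of the kernel is split into \<open>\<alpha>\<close>, which contains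
    s, and \<open>\<gamma>\<close>, which does not.\<close>
  define \<alpha> where "\<alpha> l x = a l / (2 * b l) * x\<^sup>2 + \<tau> l / b l * x - \<xi> $ l * x / b l" for l x
  define \<gamma> where "\<gamma> l = 1 / (2 * b l) * (d l * ((\<xi> $ l)\<^sup>2 + (\<tau> l)\<^sup>2) - 2 * \<xi> $ l * (d l * \<tau> l - b l * \<eta> l))" for l
  define pr where "pr l = 1 / csqrt (\<i> * of_real (2 * pi * b l))" for l
  have pr: "norm (pr l) = 1 / sqrt (2 * pi * \<bar>b l\<bar>)" for l
    by (simp add: pr_def norm_divide norm_mult abs_mult)
  have ph: "1 / (2 * b l) * (a l * x\<^sup>2 - 2 * x * (\<xi> $ l - \<tau> l) - 2 * \<xi> $ l * (d l * \<tau> l - b l * \<eta> l) + d l * ((\<xi> $ l)\<^sup>2 + (\<tau> l)\<^sup>2)) = \<gamma> l + \<alpha> l x" for l x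
    using b[of l] by (simp add: \<alpha>_def \<gamma>_def field_simps)
  have K: "olct_kernel \<kappa> (A l) x (\<xi> $ l) = qembed \<kappa> (pr l) * qexp \<kappa> (\<gamma> l) * qexp \<kappa> (\<alpha> l x)" if "pure_unit \<kappa>" for \<kappa> l x
    unfolding A olct_kernel.simps ph pr_def[symmetric] qexp_add[OF that] by (simp add: mult.assoc)
  \<comment> \<open>The right-hand kernel must have its constants on the right to leave the integral
    on that side. The reordering is legitimate because all its factors lie in the commutative copy
    of the complex numbers generated by \<open>\<kappa>\<close>.\<close>
  have K': "olct_kernel \<kappa> (A l) x (\<xi> $ l) = qexp \<kappa> (\<alpha> l x) * (qembed \<kappa> (pr l) * qexp \<kappa> (\<gamma> l))" if "pure_unit \<kappa>" for \<kappa> l x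
    unfolding K[OF that] qexp_eq qembed_mult[OF that, symmetric] by (simp add: mult_ac)
  define G where "G s = qexp \<nu> (\<alpha> 1 (s $ 1)) * of_real (h s) * qexp \<mu> (\<alpha> 2 (s $ 2))" for s :: "real^2"
  define CC where "CC = (LINT s|lborel. h s * cos (\<alpha> 1 (s $ 1)) * cos (\<alpha> 2 (s $ 2)))"
  define SC where "SC = (LINT s|lborel. h s * sin (\<alpha> 1 (s $ 1)) * cos (\<alpha> 2 (s $ 2)))"
  define CS where "CS = (LINT s|lborel. h s * cos (\<alpha> 1 (s $ 1)) * sin (\<alpha> 2 (s $ 2)))"
  define SS where "SS = (LINT s|lborel. h s * sin (\<alpha> 1 (s $ 1)) * sin (\<alpha> 2 (s $ 2)))"
  have [measurable]: "\<alpha> l \<in> borel_measurable borel" for l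
    unfolding \<alpha>_def[abs_def] by measurable
  have ib: "integrable lborel (\<lambda>s. h s * p s * q s)" if [measurable]: "p \<in> borel_measurable borel" "q \<in> borel_measurable borel"
    and "\<And>s. \<bar>p s\<bar> \<le> 1" "\<And>s. \<bar>q s\<bar> \<le> 1" for p q
  proof (rule Bochner_Integration.integrable_bound[OF h])
    show "AE s in lborel. norm (h s * p s * q s) \<le> norm (h s)"
      using that(3,4) by (auto simp: abs_mult mult.assoc intro!: mult_left_le mult_le_one)
  qed measurable
  have i: "integrable lborel (\<lambda>s. h s * cos (\<alpha> 1 (s $ 1)) * cos (\<alpha> 2 (s $ 2)))"
    "integrable lborel (\<lambda>s. h s * sin (\<alpha> 1 (s $ 1)) * cos (\<alpha> 2 (s $ 2)))"
    "integrable lborel (\<lambda>s. h s * cos (\<alpha> 1 (s $ 1)) * sin (\<alpha> 2 (s $ 2)))"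
    "integrable lborel (\<lambda>s. h s * sin (\<alpha> 1 (s $ 1)) * sin (\<alpha> 2 (s $ 2)))"
    by (rule ib; simp)+
  have Geq: "G s = (h s * cos (\<alpha> 1 (s $ 1)) * cos (\<alpha> 2 (s $ 2))) *\<^sub>R 1 + (h s * sin (\<alpha> 1 (s $ 1)) * cos (\<alpha> 2 (s $ 2))) *\<^sub>R \<nu>
      + (h s * cos (\<alpha> 1 (s $ 1)) * sin (\<alpha> 2 (s $ 2))) *\<^sub>R \<mu> + (h s * sin (\<alpha> 1 (s $ 1)) * sin (\<alpha> 2 (s $ 2))) *\<^sub>R (\<nu> * \<mu>)" for s
    by (simp add: G_def qexp_def of_real_def algebra_simps)
  have Gi: "integrable lborel G"
    unfolding Geq[abs_def] by (intro Bochner_Integration.integrable_add integrable_scaleR_left i)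
  have GI: "(LINT s|lborel. G s) = CC *\<^sub>R 1 + SC *\<^sub>R \<nu> + CS *\<^sub>R \<mu> + SS *\<^sub>R (\<nu> * \<mu>)"
    unfolding Geq CC_def SC_def CS_def SS_def using i by simp
  \<comment> \<open>The addition formulas for \<alpha>_1 + \<sigma> \<alpha>_2; the squared moduli
    for the two signs are exactly the two brackets of
    \<open>norm_square_pure_units_combination\<close>.\<close>
  have F: "olct_fourier \<sigma> h a b \<tau> \<xi> = Complex (CC - \<sigma> * SS) (SC + \<sigma> * CS)" if "\<sigma> = 1 \<or> \<sigma> = -1" for \<sigma>
  proof -
    have sg: "cos (\<sigma> * x) = cos x" "sin (\<sigma> * x) = \<sigma> * sin x" for x
      using that by auto
    have "chirp (vector [a 1 / (2 * b 1), \<sigma> * (a 2 / (2 * b 2))]) (vector [\<tau> 1 / b 1, \<sigma> * (\<tau> 2 / b 2)]) s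
         - (\<Sum>i\<in>UNIV. vector [1 / b 1, \<sigma> / b 2] $ i * \<xi> $ i * s $ i) = \<alpha> 1 (s $ 1) + \<sigma> * \<alpha> 2 (s $ 2)" for s
      by (simp add: chirp_def sum_2 \<alpha>_def vector_2 algebra_simps)
    then have "olct_fourier \<sigma> h a b \<tau> \<xi> = (LINT s|lborel. of_real (h s) * cis (\<alpha> 1 (s $ 1) + \<sigma> * \<alpha> 2 (s $ 2)))"
      by (simp add: olct_fourier_def)
    also have "\<dots> = (LINT s|lborel. of_real (h s * cos (\<alpha> 1 (s $ 1)) * cos (\<alpha> 2 (s $ 2)) - \<sigma> * (h s * sin (\<alpha> 1 (s $ 1)) * sin (\<alpha> 2 (s $ 2))))
       + \<i> * of_real (h s * sin (\<alpha> 1 (s $ 1)) * cos (\<alpha> 2 (s $ 2)) + \<sigma> * (h s * cos (\<alpha> 1 (s $ 1)) * sin (\<alpha> 2 (s $ 2)))))"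
      by (intro Bochner_Integration.integral_cong refl)
        (simp add: complex_eq_iff cos_add sin_add sg algebra_simps)
    also have "\<dots> = of_real (CC - \<sigma> * SS) + \<i> * of_real (SC + \<sigma> * CS)"
      unfolding CC_def SC_def CS_def SS_def using i
      by (simp del: of_real_add of_real_diff of_real_mult)
    finally show ?thesis by (simp add: Complex_eq)
  qed
  have "qolct \<nu> \<mu> (A 1) (A 2) (\<lambda>s. of_real (h s)) \<xi> =
     (LINT s|lborel. (qembed \<nu> (pr 1) * qexp \<nu> (\<gamma> 1)) * (G s * (qembed \<mu> (pr 2) * qexp \<mu> (\<gamma> 2))))"
    unfolding qolct_def K[OF \<nu>] K'[OF \<mu>] G_def by (simp only: mult.assoc)
  also have "\<dots> = (qembed \<nu> (pr 1) * qexp \<nu> (\<gamma> 1)) * ((LINT s|lborel. G s) * (qembed \<mu> (pr 2) * qexp \<mu> (\<gamma> 2)))"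
    using Gi by (simp add: Bochner_Integration.integral_mult_left Bochner_Integration.integral_mult_right)
  finally have "norm (qolct \<nu> \<mu> (A 1) (A 2) (\<lambda>s. of_real (h s)) \<xi>) = norm (pr 1) * (norm (LINT s|lborel. G s) * norm (pr 2))"
    by (simp add: norm_mult norm_qembed \<nu> \<mu> qexp_eq)
  then have "(norm (qolct \<nu> \<mu> (A 1) (A 2) (\<lambda>s. of_real (h s)) \<xi>))\<^sup>2 = (norm (pr 1))\<^sup>2 * (norm (pr 2))\<^sup>2 * (norm (LINT s|lborel. G s))\<^sup>2"
    by (simp add: power_mult_distrib)
  also have "(norm (pr 1))\<^sup>2 * (norm (pr 2))\<^sup>2 = 1 / ((2 * pi)\<^sup>2 * \<bar>b 1 * b 2\<bar>)"
    unfolding pr by (simp add: power_divide abs_mult power2_eq_square)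
  also have "(norm (LINT s|lborel. G s))\<^sup>2 = (1 + \<nu> \<bullet> \<mu>) / 2 * (norm (olct_fourier 1 h a b \<tau> \<xi>))\<^sup>2 + (1 - \<nu> \<bullet> \<mu>) / 2 * (norm (olct_fourier (-1) h a b \<tau> \<xi>))\<^sup>2"
    unfolding GI norm_square_pure_units_combination[OF \<nu> \<mu>] by (simp add: F cmod_power2)
  finally show ?thesis .
qed

lemma borel_measurable_vec_nth' [measurable (raw)]:
  assumes "f \<in> borel_measurable M"
  shows "(\<lambda>x. (f x :: real^'n) $ i) \<in> borel_measurable M"
  by (rule measurable_compose[OF assms]) (intro borel_measurable_continuous_onI continuous_intros)

lemma olct_fourier_measurable [measurable]:
  assumes [measurable]: "h \<in> borel_measurable borel"
  shows "olct_fourier \<sigma> h a b \<tau> \<in> borel_measurable borel"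
  unfolding olct_fourier_def[abs_def] chirp_def sum_2 by measurable

text \<open>This is \<open>chirp_plancherel\<close> for the phases of \<open>olct_fourier\<close>,
  with the Jacobian 1 / |b_1 b_2| brought to the other side. The bound is the same for both signs,
  so it survives their convex combination.\<close>

lemma olct_fourier_ge:
  fixes a b \<tau> :: "2 \<Rightarrow> real"
  assumes b: "\<And>l. b l \<noteq> 0" and \<sigma>: "\<sigma> = 1 \<or> \<sigma> = -1"
    and d: "has_dir_deriv h h' (axis k 1)"
    and h: "rapid h" "continuous_on UNIV h"
    and h': "rapid h'" "continuous_on UNIV h'"
  shows "ennreal ((2 * pi)\<^sup>2 * \<bar>b 1 * b 2\<bar> * (LINT s|lborel. (h' s)\<^sup>2)) \<le>
    (\<integral>\<^sup>+\<xi>. ennreal ((\<xi> $ k / b k)\<^sup>2 * (norm (olct_fourier \<sigma> h a b \<tau> \<xi>))\<^sup>2) \<partial>lborel)"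
proof -
  \<comment> \<open>The sign \<open>\<sigma>\<close> is absorbed into the second frequency scale; it
    is lost again in the square and in the absolute value of the Jacobian.\<close>
  define \<beta> :: "real^2" where "\<beta> = vector [1 / b 1, \<sigma> / b 2]"
  have \<beta>0: "\<beta> $ i \<noteq> 0" for i
    using exhaust_2[of i] b \<sigma> by (auto simp: \<beta>_def vector_2)
  have \<beta>k: "(\<beta> $ k * \<xi> $ k)\<^sup>2 = (\<xi> $ k / b k)\<^sup>2" for \<xi> :: "real^2"
    using exhaust_2[of k] \<sigma> by (auto simp: \<beta>_def vector_2 power_mult_distrib power_divide)
  have \<beta>b: "\<bar>\<beta> $ 1 * \<beta> $ 2\<bar> = 1 / \<bar>b 1 * b 2\<bar>"
    using \<sigma> by (auto simp: \<beta>_def vector_2 abs_mult)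
  define I where "I = (\<integral>\<^sup>+\<xi>. ennreal ((\<xi> $ k / b k)\<^sup>2 * (norm (olct_fourier \<sigma> h a b \<tau> \<xi>))\<^sup>2) \<partial>lborel)"
  have "ennreal ((2 * pi)\<^sup>2 * (LINT s|lborel. (h' s)\<^sup>2)) \<le> ennreal (1 / \<bar>b 1 * b 2\<bar>) * I"
    using chirp_plancherel[OF d h h' \<beta>0, of "vector [a 1 / (2 * b 1), \<sigma> * (a 2 / (2 * b 2))]" "vector [\<tau> 1 / b 1, \<sigma> * (\<tau> 2 / b 2)]"]
    unfolding \<beta>k \<beta>b unfolding \<beta>_def olct_fourier_def[symmetric] I_def .
  then have "ennreal \<bar>b 1 * b 2\<bar> * ennreal ((2 * pi)\<^sup>2 * (LINT s|lborel. (h' s)\<^sup>2)) \<le> ennreal \<bar>b 1 * b 2\<bar> * (ennreal (1 / \<bar>b 1 * b 2\<bar>) * I)"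
    by (rule mult_left_mono) simp
  also have "\<dots> = I"
    using b by (simp flip: mult.assoc ennreal_mult)
  finally show ?thesis
    unfolding I_def by (simp add: mult_ac flip: ennreal_mult)
qed

text \<open>Both Fourier integrals obey the same lower bound and their weights add up to one, so the
  angle between \<open>\<nu>\<close> and \<open>\<mu>\<close> drops out. The measurability claim
  serves to split the integral over the four components later.\<close>

lemma qolct_real_ge:
  fixes a b c d \<tau> \<eta> :: "2 \<Rightarrow> real" and h h' :: "real^2 \<Rightarrow> real"
  assumes \<nu>: "pure_unit \<nu>" and \<mu>: "pure_unit \<mu>"
    and A: "\<And>l. A l = (a l, b l, c l, d l, \<tau> l, \<eta> l)" and b: "\<And>l. b l \<noteq> 0"
    and d: "has_dir_deriv h h' (axis k 1)"
    and h: "rapid h" "continuous_on UNIV h"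
    and h': "rapid h'" "continuous_on UNIV h'"
  shows "(\<lambda>\<xi>. (norm (qolct \<nu> \<mu> (A 1) (A 2) (\<lambda>s. of_real (h s)) \<xi>))\<^sup>2) \<in> borel_measurable borel" (is ?m)
    and "ennreal (1 / (4 * pi\<^sup>2) * (LINT s|lborel. (h' s)\<^sup>2)) \<le>
      (\<integral>\<^sup>+\<xi>. ennreal ((\<xi> $ k / (2 * pi * b k))\<^sup>2 * (norm (qolct \<nu> \<mu> (A 1) (A 2) (\<lambda>s. of_real (h s)) \<xi>))\<^sup>2) \<partial>lborel)" (is ?i)
proof -
  have hm[measurable]: "h \<in> borel_measurable borel" using h(2) by (rule borel_measurable_continuous_onI)
  note eq = norm_qolct_real[OF \<nu> \<mu> A b rapid_integrable[OF h(1) hm]]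
  show ?m
    by (subst eq[abs_def]) measurable
  define D where "D = (LINT s|lborel. (h' s)\<^sup>2)"
  define N where "N \<sigma> = (\<integral>\<^sup>+\<xi>. ennreal ((\<xi> $ k / b k)\<^sup>2 * (norm (olct_fourier \<sigma> h a b \<tau> \<xi>))\<^sup>2) \<partial>lborel)" for \<sigma>
  \<comment> \<open>Collects the squared modulus of the prefactors, the convex weight, and the 1 /
    (2 pi)^2 coming from \<xi>_k / (2 pi b_k).\<close>
  define w where "w \<sigma> = 1 / ((2 * pi)\<^sup>2 * \<bar>b 1 * b 2\<bar>) * ((1 + \<sigma> * (\<nu> \<bullet> \<mu>)) / 2) / (2 * pi)\<^sup>2" for \<sigma> :: real
  have D0: "0 \<le> D" unfolding D_def by simp
  \<comment> \<open>Cauchy-Schwarz makes both weights non-negative, so that lower bounds may be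
    inserted term by term.\<close>
  have "\<bar>\<nu> \<bullet> \<mu>\<bar> \<le> 1"
    using Cauchy_Schwarz_ineq2[of \<nu> \<mu>] pure_unit_norm[OF \<nu>] pure_unit_norm[OF \<mu>] by simp
  then have w0: "0 \<le> w 1" "0 \<le> w (-1)" unfolding w_def by auto
  have N: "ennreal ((2 * pi)\<^sup>2 * \<bar>b 1 * b 2\<bar> * D) \<le> N \<sigma>" if "\<sigma> = 1 \<or> \<sigma> = -1" for \<sigma>
    unfolding N_def D_def by (rule olct_fourier_ge[OF b that d h h'])
  have "1 / (4 * pi\<^sup>2) * D = w 1 * ((2 * pi)\<^sup>2 * \<bar>b 1 * b 2\<bar> * D) + w (-1) * ((2 * pi)\<^sup>2 * \<bar>b 1 * b 2\<bar> * D)"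
  proof -
    have "w 1 + w (-1) = 1 / ((2 * pi)\<^sup>2 * \<bar>b 1 * b 2\<bar>) / (2 * pi)\<^sup>2"
    proof -
      have "w 1 + w (-1) = 1 / ((2 * pi)\<^sup>2 * \<bar>b 1 * b 2\<bar>) * ((1 + 1 * (\<nu> \<bullet> \<mu>)) / 2 + (1 + -1 * (\<nu> \<bullet> \<mu>)) / 2) / (2 * pi)\<^sup>2"
        unfolding w_def by (simp only: distrib_left add_divide_distrib)
      also have "(1 + 1 * (\<nu> \<bullet> \<mu>)) / 2 + (1 + -1 * (\<nu> \<bullet> \<mu>)) / 2 = 1"
        by (simp add: field_simps)
      finally show ?thesis by simp
    qed
    then have "(w 1 + w (-1)) * ((2 * pi)\<^sup>2 * \<bar>b 1 * b 2\<bar>) = 1 / (2 * pi)\<^sup>2"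
      using b by simp
    then have "(w 1 + w (-1)) * ((2 * pi)\<^sup>2 * \<bar>b 1 * b 2\<bar>) * D = 1 / (2 * pi)\<^sup>2 * D"
      by simp
    then show ?thesis by (simp add: distrib_right power_mult_distrib mult.assoc)
  qed
  then have "ennreal (1 / (4 * pi\<^sup>2) * D) = ennreal (w 1) * ennreal ((2 * pi)\<^sup>2 * \<bar>b 1 * b 2\<bar> * D) + ennreal (w (-1)) * ennreal ((2 * pi)\<^sup>2 * \<bar>b 1 * b 2\<bar> * D)"
    using w0 D0 by (simp add: ennreal_plus ennreal_mult)
  also have "\<dots> \<le> ennreal (w 1) * N 1 + ennreal (w (-1)) * N (-1)"
    by (intro add_mono mult_left_mono N) auto
  also have "\<dots> = (\<integral>\<^sup>+\<xi>. ennreal (w 1) * ennreal ((\<xi> $ k / b k)\<^sup>2 * (norm (olct_fourier 1 h a b \<tau> \<xi>))\<^sup>2)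
      + ennreal (w (-1)) * ennreal ((\<xi> $ k / b k)\<^sup>2 * (norm (olct_fourier (-1) h a b \<tau> \<xi>))\<^sup>2) \<partial>lborel)"
    unfolding N_def by (subst nn_integral_add) (simp_all add: nn_integral_cmult)
  also have "\<dots> = (\<integral>\<^sup>+\<xi>. ennreal ((\<xi> $ k / (2 * pi * b k))\<^sup>2 * (norm (qolct \<nu> \<mu> (A 1) (A 2) (\<lambda>s. of_real (h s)) \<xi>))\<^sup>2) \<partial>lborel)"
  proof (intro nn_integral_cong)
    fix \<xi> :: "real^2"
    have "(\<xi> $ k / (2 * pi * b k))\<^sup>2 * (norm (qolct \<nu> \<mu> (A 1) (A 2) (\<lambda>s. of_real (h s)) \<xi>))\<^sup>2 =
      w 1 * ((\<xi> $ k / b k)\<^sup>2 * (norm (olct_fourier 1 h a b \<tau> \<xi>))\<^sup>2) + w (-1) * ((\<xi> $ k / b k)\<^sup>2 * (norm (olct_fourier (-1) h a b \<tau> \<xi>))\<^sup>2)"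
    proof -
      have dist: "E / Q * (C * (x * X + y * Y)) = C * x / Q * (E * X) + C * y / Q * (E * Y)" for E Q C x X y Y :: real
        by (simp add: divide_inverse algebra_simps)
      have sq: "(\<xi> $ k / (2 * pi * b k))\<^sup>2 = (\<xi> $ k / b k)\<^sup>2 / (2 * pi)\<^sup>2"
        by (simp add: power_divide power_mult_distrib)
      show ?thesis
        by (subst eq) (simp only: sq dist w_def mult_1_left mult_minus1 diff_conv_add_uminus)
    qed
    then show "ennreal (w 1) * ennreal ((\<xi> $ k / b k)\<^sup>2 * (norm (olct_fourier 1 h a b \<tau> \<xi>))\<^sup>2)
      + ennreal (w (-1)) * ennreal ((\<xi> $ k / b k)\<^sup>2 * (norm (olct_fourier (-1) h a b \<tau> \<xi>))\<^sup>2) =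
      ennreal ((\<xi> $ k / (2 * pi * b k))\<^sup>2 * (norm (qolct \<nu> \<mu> (A 1) (A 2) (\<lambda>s. of_real (h s)) \<xi>))\<^sup>2)"
      using w0 by (simp add: ennreal_plus ennreal_mult)
  qed
  finally show ?i unfolding D_def .
qed


section \<open>The correlation of two Schwartz functions\<close>

lemma bounded_linear_components:
  "bounded_linear qre" "bounded_linear qi" "bounded_linear qj" "bounded_linear qk" "bounded_linear qcnj"
proof -
  have "qre = (\<lambda>x. x \<bullet> Quat 1 0 0 0)" "qi = (\<lambda>x. x \<bullet> Quat 0 1 0 0)" "qj = (\<lambda>x. x \<bullet> Quat 0 0 1 0)" "qk = (\<lambda>x. x \<bullet> Quat 0 0 0 1)"
    by (auto simp: inner_quat_def)
  then show "bounded_linear qre" "bounded_linear qi" "bounded_linear qj" "bounded_linear qk"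
    by (metis bounded_linear_inner_left)+
  show "bounded_linear qcnj"
    by (rule bounded_linear_intro[where K=1]) (auto simp: quat_eq_iff norm_quat_eq)
qed

lemma norm_qcnj [simp]: "norm (qcnj x) = norm x"
  by (simp add: norm_quat_eq)

lemma norm_square_quat: "(norm x)\<^sup>2 = (qre x)\<^sup>2 + (qi x)\<^sup>2 + (qj x)\<^sup>2 + (qk x)\<^sup>2"
  by (simp add: norm_quat_eq)

text \<open>Converts the weight 1 + |x|^n into (1 + |x|)^n at the price of 2^n, since 1 + |x| is at
  most twice the maximum of 1 and |x|.\<close>

lemma schwartz_bound_rapid:
  fixes u :: "real^2 \<Rightarrow> quat"
  assumes "\<And>n. bdd_above (range (\<lambda>x. (1 + norm x ^ n) * norm (u x)))"
  shows "rapid u"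
  unfolding rapid_def
proof
  fix n
  obtain C where C: "\<And>x. (1 + norm x ^ n) * norm (u x) \<le> C"
    using assms[of n] unfolding bdd_above_def by auto
  have "(1 + norm x) ^ n * norm (u x) \<le> 2 ^ n * C" for x
  proof -
    have "(1 + norm x) ^ n \<le> (2 * max 1 (norm x)) ^ n"
      by (intro power_mono) auto
    also have "\<dots> \<le> 2 ^ n * (1 + norm x ^ n)"
      by (auto simp: power_mult_distrib max_def)
    finally have "(1 + norm x) ^ n * norm (u x) \<le> 2 ^ n * (1 + norm x ^ n) * norm (u x)"
      by (rule mult_right_mono) simp
    also have "\<dots> \<le> 2 ^ n * C"
      unfolding mult.assoc by (intro mult_left_mono C) simp
    finally show ?thesis .
  qed
  then show "\<exists>C. \<forall>x. (1 + norm x) ^ n * norm (u x) \<le> C" by blast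
qed

lemma schwartzD:
  assumes "schwartz f"
  shows "rapid f" "continuous_on UNIV f" "rapid (partial k f)" "continuous_on UNIV (partial k f)"
    "has_dir_deriv f (partial k f) (axis k 1)"
proof -
  have sm: "foldr partial ks f differentiable (at x)" for ks x
    using assms unfolding schwartz_def smooth_def by blast
  have f: "f differentiable (at x)" "partial k f differentiable (at x)" for x
    using sm[of "[]"] sm[of "[k]"] by simp_all
  then show "continuous_on UNIV f" "continuous_on UNIV (partial k f)"
    by (auto intro!: continuous_at_imp_continuous_on differentiable_imp_continuous_within)
  have b: "rapid (mpartial \<alpha> f)" for \<alpha>
    by (rule schwartz_bound_rapid) (rule assms[unfolded schwartz_def, THEN conjunct2, rule_format])
  show "rapid f"
    using b[of "\<lambda>_. 0"] by (simp add: mpartial_def)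
  show "rapid (partial k f)"
    using b[of "\<lambda>i. if i = k then 1 else 0"] exhaust_2[of k] by (auto simp: mpartial_def)
  show "has_dir_deriv f (partial k f) (axis k 1)"
    unfolding has_dir_deriv_def
  proof
    fix x
    have "(f has_derivative frechet_derivative f (at x)) (at (x + 0 *\<^sub>R axis k 1))"
      using f(1)[of x] by (simp add: frechet_derivative_works)
    moreover have "((\<lambda>r. x + r *\<^sub>R axis k 1) has_vector_derivative axis k 1) (at 0)"
      by (auto intro!: derivative_eq_intros)
    ultimately show "((\<lambda>r. f (x + r *\<^sub>R axis k 1)) has_vector_derivative partial k f x) (at 0)"
      unfolding partial_def using vector_derivative_diff_chain_within[of "\<lambda>r. x + r *\<^sub>R axis k 1" "axis k 1" 0 UNIV f]
      by (auto simp: o_def intro: has_derivative_at_withinI)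
  qed
qed

section \<open>Regularity of the correlation in s and its integral over the plane of pairs (t,
  s)\<close>

lemma has_dir_deriv_affine:
  assumes "has_dir_deriv u u' e"
  shows "has_dir_deriv (\<lambda>s. u (t + c *\<^sub>R s)) (\<lambda>s. c *\<^sub>R u' (t + c *\<^sub>R s)) e"
  unfolding has_dir_deriv_def
proof
  fix x
  have 1: "((\<lambda>r. c * r) has_vector_derivative c) (at 0)"
    by (auto intro!: derivative_eq_intros simp: has_real_derivative_iff_has_vector_derivative[symmetric])
  have "((\<lambda>r. u ((t + c *\<^sub>R x) + r *\<^sub>R e)) has_vector_derivative u' (t + c *\<^sub>R x)) (at (c * 0))"
    using assms unfolding has_dir_deriv_def by simp
  from vector_diff_chain_at[OF 1 this]
  show "((\<lambda>r. u (t + c *\<^sub>R (x + r *\<^sub>R e))) has_vector_derivative c *\<^sub>R u' (t + c *\<^sub>R x)) (at 0)"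
    by (simp add: o_def algebra_simps)
qed

text \<open>At fixed t one decaying factor already makes the correlation and its derivative decay in
  s; the other factor enters through its bound only.\<close>

lemma rapid_bilinear_bounded:
  assumes "bounded_bilinear B" "rapid u" "\<And>x. norm (v x) \<le> N"
  shows "rapid (\<lambda>x. B (u x) (v x))"
proof -
  obtain K where K: "K \<ge> 0" "\<And>a b. norm (B a b) \<le> norm a * norm b * K"
    using bounded_bilinear.nonneg_bounded[OF assms(1)] by blast
  show ?thesis
  proof (rule rapid_dominated[OF assms(2), of _ "N * K" 0])
    fix x
    have "norm (B (u x) (v x)) \<le> norm (u x) * (norm (v x) * K)"
      using K(2)[of "u x" "v x"] by (simp add: mult.assoc)
    also have "\<dots> \<le> norm (u x) * (N * K)"
      by (intro mult_left_mono mult_right_mono assms(3) K(1)) simp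
    finally show "norm (B (u x) (v x)) \<le> N * K * (1 + norm x) ^ 0 * norm (u x)"
      by (simp add: mult_ac)
  qed
qed

text \<open>The partial derivative in s_k, at fixed t, of \<open>wvd_corr f g t\<close>, in the
  order in which \<open>has_dir_deriv_bilinear\<close> produces it. The coefficients are the inner
  derivatives 1/2 and -1/2; conjugation is real linear and commutes with differentiation.\<close>

definition corr_deriv :: "2 \<Rightarrow> (real^2 \<Rightarrow> quat) \<Rightarrow> (real^2 \<Rightarrow> quat) \<Rightarrow> real^2 \<Rightarrow> real^2 \<Rightarrow> quat" where
  "corr_deriv k f g t s = f (t + s /\<^sub>R 2) * (- 1 / 2) *\<^sub>R qcnj (partial k g (t - s /\<^sub>R 2)) +
     (1 / 2) *\<^sub>R partial k f (t + s /\<^sub>R 2) * qcnj (g (t - s /\<^sub>R 2))"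

lemma wvd_corr_regularity:
  assumes f: "schwartz f" and g: "schwartz g"
  shows "has_dir_deriv (wvd_corr f g t) (corr_deriv k f g t) (axis k 1)"
    and "rapid (wvd_corr f g t)" "continuous_on UNIV (wvd_corr f g t)"
    and "rapid (corr_deriv k f g t)" "continuous_on UNIV (corr_deriv k f g t)"
proof -
  note F = schwartzD[OF f] and G = schwartzD[OF g]
  have pm: "t + s /\<^sub>R 2 = t + (1 / 2) *\<^sub>R s" "t - s /\<^sub>R 2 = t + (- 1 / 2) *\<^sub>R s" for s :: "real^2"
    by (simp_all add: inverse_eq_divide)
  have "has_dir_deriv (\<lambda>s. qcnj (g (t + (- 1 / 2) *\<^sub>R s))) (\<lambda>s. qcnj ((- 1 / 2) *\<^sub>R partial k g (t + (- 1 / 2) *\<^sub>R s))) (axis k 1)"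
    by (rule has_dir_deriv_bounded_linear[OF bounded_linear_components(5) has_dir_deriv_affine[OF G(5)]])
  then have "has_dir_deriv (\<lambda>s. qcnj (g (t + (- 1 / 2) *\<^sub>R s))) (\<lambda>s. (- 1 / 2) *\<^sub>R qcnj (partial k g (t + (- 1 / 2) *\<^sub>R s))) (axis k 1)"
    by (simp only: linear_scale[OF bounded_linear.linear[OF bounded_linear_components(5)]])
  from has_dir_deriv_bilinear[OF bounded_bilinear_mult has_dir_deriv_affine[OF F(5), of t "1/2"] this]
  show "has_dir_deriv (wvd_corr f g t) (corr_deriv k f g t) (axis k 1)"
    unfolding wvd_corr_def[abs_def] corr_deriv_def[abs_def] pm .
  obtain N where N: "\<And>x. norm (g x) \<le> N" using rapid_bounded[OF G(1)] by blast
  obtain N' where N': "\<And>x. norm (partial k g x) \<le> N'" using rapid_bounded[OF G(3)] by blast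
  show "rapid (wvd_corr f g t)"
    unfolding wvd_corr_def[abs_def] pm
    by (rule rapid_bilinear_bounded[OF bounded_bilinear_mult rapid_affine[OF F(1)], of _ _ N]) (simp_all add: N)
  show "rapid (corr_deriv k f g t)"
    unfolding corr_deriv_def[abs_def] pm
  proof (rule rapid_add)
    show "rapid (\<lambda>s. f (t + (1 / 2) *\<^sub>R s) * (- 1 / 2) *\<^sub>R qcnj (partial k g (t + (- 1 / 2) *\<^sub>R s)))"
      by (rule rapid_bilinear_bounded[OF bounded_bilinear_mult rapid_affine[OF F(1)], of _ _ "N' / 2"]) (simp_all add: N')
    have "rapid (\<lambda>s. partial k f (t + (1 / 2) *\<^sub>R s) * ((1 / 2) *\<^sub>R qcnj (g (t + (- 1 / 2) *\<^sub>R s))))"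
      by (rule rapid_bilinear_bounded[OF bounded_bilinear_mult rapid_affine[OF F(3)], of _ _ "N / 2"]) (simp_all add: N)
    then show "rapid (\<lambda>s. (1 / 2) *\<^sub>R partial k f (t + (1 / 2) *\<^sub>R s) * qcnj (g (t + (- 1 / 2) *\<^sub>R s)))"
      by simp
  qed
  have c: "continuous_on UNIV (\<lambda>s. u (t + c *\<^sub>R s))" if "continuous_on UNIV u" for u :: "real^2 \<Rightarrow> quat" and c
    by (rule continuous_on_compose2[OF that]) (auto intro!: continuous_intros)
  show "continuous_on UNIV (wvd_corr f g t)" "continuous_on UNIV (corr_deriv k f g t)"
    unfolding wvd_corr_def[abs_def] corr_deriv_def[abs_def] pm
    by (intro continuous_intros c F G bounded_linear.continuous_on[OF bounded_linear_components(5)])+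
qed

text \<open>The linear change of variables is done in two one-vector substitutions around Tonelli's
  theorem: u = t + s/2 gives a factor 4, and x = 2 t - u gives 1/4.\<close>

lemma nn_integral_corr:
  fixes \<phi> \<psi> :: "real^2 \<Rightarrow> ennreal"
  assumes [measurable]: "\<phi> \<in> borel_measurable borel" "\<psi> \<in> borel_measurable borel"
  shows "(\<integral>\<^sup>+t. \<integral>\<^sup>+s. \<phi> (t + s /\<^sub>R 2) * \<psi> (t - s /\<^sub>R 2) \<partial>lborel \<partial>lborel) = (\<integral>\<^sup>+x. \<phi> x \<partial>lborel) * (\<integral>\<^sup>+x. \<psi> x \<partial>lborel)"
proof -
  have q: "ennreal 4 * (ennreal (1/4) * x) = x" for x
  proof -
    have "ennreal 4 * ennreal (1/4) = 1"
      by (subst ennreal_mult[symmetric]) simp_all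
    then show ?thesis
      by (simp only: mult_1_left flip: mult.assoc)
  qed
  have 1: "(\<integral>\<^sup>+s. \<phi> (t + s /\<^sub>R 2) * \<psi> (t - s /\<^sub>R 2) \<partial>lborel) = ennreal 4 * (\<integral>\<^sup>+u. \<phi> u * \<psi> (2 *\<^sub>R t - u) \<partial>lborel)" for t
  proof -
    have "(\<integral>\<^sup>+u. \<phi> u * \<psi> (2 *\<^sub>R t - u) \<partial>lborel) =
       ennreal (\<bar>inverse 2\<bar> ^ DIM(real^2)) * (\<integral>\<^sup>+s. \<phi> (t + inverse 2 *\<^sub>R s) * \<psi> (2 *\<^sub>R t - (t + inverse 2 *\<^sub>R s)) \<partial>lborel)"
      by (rule nn_integral_lborel_affine) auto
    also have "\<dots> = ennreal (1/4) * (\<integral>\<^sup>+s. \<phi> (t + s /\<^sub>R 2) * \<psi> (t - s /\<^sub>R 2) \<partial>lborel)"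
      by (simp add: scaleR_2 power2_eq_square algebra_simps)
    finally show ?thesis by (simp only: q)
  qed
  have 2: "ennreal 4 * (\<integral>\<^sup>+t. \<psi> (2 *\<^sub>R t - u) \<partial>lborel) = (\<integral>\<^sup>+x. \<psi> x \<partial>lborel)" for u
    using nn_integral_lborel_affine[of \<psi> 2 "- u"] by simp
  have "(\<integral>\<^sup>+t. \<integral>\<^sup>+s. \<phi> (t + s /\<^sub>R 2) * \<psi> (t - s /\<^sub>R 2) \<partial>lborel \<partial>lborel) =
     ennreal 4 * (\<integral>\<^sup>+t. \<integral>\<^sup>+u. \<phi> u * \<psi> (2 *\<^sub>R t - u) \<partial>lborel \<partial>lborel)"
    unfolding 1 by (rule nn_integral_cmult) measurable
  also have "(\<integral>\<^sup>+t. \<integral>\<^sup>+u. \<phi> u * \<psi> (2 *\<^sub>R t - u) \<partial>lborel \<partial>lborel) = (\<integral>\<^sup>+u. \<integral>\<^sup>+t. \<phi> u * \<psi> (2 *\<^sub>R t - u) \<partial>lborel \<partial>lborel)"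
    by (rule lborel_pair.Fubini') measurable
  also have "\<dots> = (\<integral>\<^sup>+u. \<phi> u * (\<integral>\<^sup>+t. \<psi> (2 *\<^sub>R t - u) \<partial>lborel) \<partial>lborel)"
    by (simp add: nn_integral_cmult)
  also have "ennreal 4 * \<dots> = (\<integral>\<^sup>+u. \<phi> u * (ennreal 4 * (\<integral>\<^sup>+t. \<psi> (2 *\<^sub>R t - u) \<partial>lborel)) \<partial>lborel)"
    by (subst nn_integral_cmult[symmetric]) (simp_all add: mult_ac)
  also have "\<dots> = (\<integral>\<^sup>+x. \<phi> x \<partial>lborel) * (\<integral>\<^sup>+x. \<psi> x \<partial>lborel)"
    unfolding 2 by (simp add: nn_integral_multc)
  finally show ?thesis .
qed

text \<open>Each component of the correlation is a real function whose derivative is the same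
  component of \<open>corr_deriv\<close>. The four real estimates add up to the component-wise norm
  on one side and to the full quaternion norm of the derivative on the other.\<close>

lemma wvd_norm_ge:
  fixes a b c d \<tau> \<eta> :: "2 \<Rightarrow> real"
  assumes \<nu>: "pure_unit \<nu>" and \<mu>: "pure_unit \<mu>"
    and A: "\<And>l. A l = (a l, b l, c l, d l, \<tau> l, \<eta> l)" and b: "\<And>l. b l \<noteq> 0"
    and f: "schwartz f" and g: "schwartz g"
  shows "ennreal (1 / (4 * pi\<^sup>2) * (LINT s|lborel. (norm (corr_deriv k f g t s))\<^sup>2)) \<le>
    (\<integral>\<^sup>+\<xi>. ennreal ((wvd_norm (\<xi> $ k / (2 * pi * b k)) \<nu> \<mu> (A 1) (A 2) f g t \<xi>)\<^sup>2) \<partial>lborel)"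
proof -
  have H: "has_dir_deriv (wvd_corr f g t) (corr_deriv k f g t) (axis k 1)"
    "rapid (wvd_corr f g t)" "continuous_on UNIV (wvd_corr f g t)"
    "rapid (corr_deriv k f g t)" "continuous_on UNIV (corr_deriv k f g t)"
    by (rule wvd_corr_regularity[OF f g])+
  define Q where "Q L \<xi> = (norm (qolct \<nu> \<mu> (A 1) (A 2) (\<lambda>s. of_real (L (wvd_corr f g t s))) \<xi>))\<^sup>2" for L :: "quat \<Rightarrow> real" and \<xi>
  define D where "D L = (LINT s|lborel. (L (corr_deriv k f g t s))\<^sup>2)" for L :: "quat \<Rightarrow> real"
  define r where "r \<xi> = \<xi> $ k / (2 * pi * b k)" for \<xi> :: "real^2"
  have [measurable]: "r \<in> borel_measurable borel" unfolding r_def[abs_def] by measurable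
  \<comment> \<open>The four component maps are handled together as an arbitrary bounded linear
    functional \<open>L\<close>.\<close>
  have L: "Q L \<in> borel_measurable borel"
    "ennreal (1 / (4 * pi\<^sup>2) * D L) \<le> (\<integral>\<^sup>+\<xi>. ennreal ((r \<xi>)\<^sup>2 * Q L \<xi>) \<partial>lborel)"
    "integrable lborel (\<lambda>s. (L (corr_deriv k f g t s))\<^sup>2)"
    if bl: "bounded_linear L" for L
  proof -
    obtain K where K: "\<And>x. norm (L x) \<le> norm x * K" using bounded_linear.bounded[OF bl] by blast
    have ra: "rapid (\<lambda>s. L (u s))" if "rapid u" for u :: "real^2 \<Rightarrow> quat"
      by (rule rapid_dominated[OF that, of _ K 0]) (use K in \<open>simp add: mult.commute\<close>)
    note * = has_dir_deriv_bounded_linear[OF bl H(1)] ra[OF H(2)] bounded_linear.continuous_on[OF bl H(3)] ra[OF H(4)] bounded_linear.continuous_on[OF bl H(5)]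
    show "Q L \<in> borel_measurable borel"
      unfolding Q_def[abs_def] by (rule qolct_real_ge(1)[OF \<nu> \<mu> A b *])
    show "ennreal (1 / (4 * pi\<^sup>2) * D L) \<le> (\<integral>\<^sup>+\<xi>. ennreal ((r \<xi>)\<^sup>2 * Q L \<xi>) \<partial>lborel)"
      unfolding Q_def r_def D_def by (rule qolct_real_ge(2)[OF \<nu> \<mu> A b *])
    show "integrable lborel (\<lambda>s. (L (corr_deriv k f g t s))\<^sup>2)"
      using integrable_rapid_norm_square[OF *(4) borel_measurable_continuous_onI[OF *(5)]] by simp
  qed
  note C = L[OF bounded_linear_components(1)] L[OF bounded_linear_components(2)] L[OF bounded_linear_components(3)] L[OF bounded_linear_components(4)]
  note [measurable] = C(1,4,7,10)
  have D0: "0 \<le> D L" for L by (simp add: D_def)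
  have "(LINT s|lborel. (norm (corr_deriv k f g t s))\<^sup>2) = D qre + D qi + D qj + D qk"
    unfolding norm_square_quat D_def using C(3,6,9,12) by simp
  then have "ennreal (1 / (4 * pi\<^sup>2) * (LINT s|lborel. (norm (corr_deriv k f g t s))\<^sup>2)) =
     ennreal (1 / (4 * pi\<^sup>2) * D qre) + ennreal (1 / (4 * pi\<^sup>2) * D qi) + ennreal (1 / (4 * pi\<^sup>2) * D qj) + ennreal (1 / (4 * pi\<^sup>2) * D qk)"
    using D0 by (simp add: ennreal_plus[symmetric] distrib_left add_divide_distrib del: ennreal_plus)
  also have "\<dots> \<le> (\<integral>\<^sup>+\<xi>. ennreal ((r \<xi>)\<^sup>2 * Q qre \<xi>) \<partial>lborel) + (\<integral>\<^sup>+\<xi>. ennreal ((r \<xi>)\<^sup>2 * Q qi \<xi>) \<partial>lborel)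
      + (\<integral>\<^sup>+\<xi>. ennreal ((r \<xi>)\<^sup>2 * Q qj \<xi>) \<partial>lborel) + (\<integral>\<^sup>+\<xi>. ennreal ((r \<xi>)\<^sup>2 * Q qk \<xi>) \<partial>lborel)"
    by (intro add_mono C)
  also have "\<dots> = (\<integral>\<^sup>+\<xi>. ennreal ((r \<xi>)\<^sup>2 * Q qre \<xi>) + ennreal ((r \<xi>)\<^sup>2 * Q qi \<xi>) + ennreal ((r \<xi>)\<^sup>2 * Q qj \<xi>) + ennreal ((r \<xi>)\<^sup>2 * Q qk \<xi>) \<partial>lborel)"
    by (simp add: nn_integral_add)
  also have "\<dots> = (\<integral>\<^sup>+\<xi>. ennreal ((wvd_norm (r \<xi>) \<nu> \<mu> (A 1) (A 2) f g t \<xi>)\<^sup>2) \<partial>lborel)"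
  proof (intro nn_integral_cong)
    fix \<xi>
    have Q0: "0 \<le> Q L \<xi>" for L by (simp add: Q_def)
    have "(wvd_norm (r \<xi>) \<nu> \<mu> (A 1) (A 2) f g t \<xi>)\<^sup>2 = (r \<xi>)\<^sup>2 * (Q qre \<xi> + Q qi \<xi> + Q qj \<xi> + Q qk \<xi>)"
      unfolding wvd_norm_def Q_def by (simp add: power_mult_distrib)
    then show "ennreal ((r \<xi>)\<^sup>2 * Q qre \<xi>) + ennreal ((r \<xi>)\<^sup>2 * Q qi \<xi>) + ennreal ((r \<xi>)\<^sup>2 * Q qj \<xi>) + ennreal ((r \<xi>)\<^sup>2 * Q qk \<xi>)
      = ennreal ((wvd_norm (r \<xi>) \<nu> \<mu> (A 1) (A 2) f g t \<xi>)\<^sup>2)"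
      using Q0 by (simp add: distrib_left)
  qed
  finally show ?thesis unfolding r_def .
qed

section \<open>Finiteness of the double integrals and the discriminant\<close>

lemma nn_integral_corr_square:
  fixes u v :: "real^2 \<Rightarrow> quat"
  assumes "rapid u" "rapid v" and [measurable]: "u \<in> borel_measurable borel" "v \<in> borel_measurable borel"
  shows "(\<integral>\<^sup>+t. \<integral>\<^sup>+s. ennreal ((norm (u (t + s /\<^sub>R 2)))\<^sup>2 * (norm (v (t - s /\<^sub>R 2)))\<^sup>2) \<partial>lborel \<partial>lborel) =
    ennreal ((l2norm u)\<^sup>2 * (l2norm v)\<^sup>2)"
proof -
  have n: "(\<integral>\<^sup>+x. ennreal ((norm (w x))\<^sup>2) \<partial>lborel) = ennreal ((l2norm w)\<^sup>2)"
    if "rapid w" "w \<in> borel_measurable borel" for w :: "real^2 \<Rightarrow> quat"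
    using integrable_rapid_norm_square[OF that] by (subst nn_integral_eq_integral) (simp_all add: l2norm_def)
  show ?thesis
    using nn_integral_corr[of "\<lambda>x. ennreal ((norm (u x))\<^sup>2)" "\<lambda>x. ennreal ((norm (v x))\<^sup>2)"] n[of u] n[of v] assms
    by (simp add: ennreal_mult)
qed

text \<open>Fits both finite quantities of the main proof: s_k times the correlation, and its
  derivative, each split into two products of a function of t + s/2 and a function of t - s/2. The
  factors 2 allow for the square of a sum of two terms.\<close>

lemma nn_integral_corr_finite:
  fixes u v u' v' :: "real^2 \<Rightarrow> quat"
  assumes "rapid u" "rapid v" "rapid u'" "rapid v'"
    and [measurable]: "u \<in> borel_measurable borel" "v \<in> borel_measurable borel"
      "u' \<in> borel_measurable borel" "v' \<in> borel_measurable borel"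
    and le: "\<And>t s. F t s \<le> 2 * ((norm (u (t + s /\<^sub>R 2)))\<^sup>2 * (norm (v (t - s /\<^sub>R 2)))\<^sup>2)
       + 2 * ((norm (u' (t + s /\<^sub>R 2)))\<^sup>2 * (norm (v' (t - s /\<^sub>R 2)))\<^sup>2)"
  shows "(\<integral>\<^sup>+t. \<integral>\<^sup>+s. ennreal (F t s) \<partial>lborel \<partial>lborel) < top"
proof -
  have "(\<integral>\<^sup>+t. \<integral>\<^sup>+s. ennreal (F t s) \<partial>lborel \<partial>lborel) \<le>
    (\<integral>\<^sup>+t. \<integral>\<^sup>+s. ennreal 2 * ennreal ((norm (u (t + s /\<^sub>R 2)))\<^sup>2 * (norm (v (t - s /\<^sub>R 2)))\<^sup>2)
       + ennreal 2 * ennreal ((norm (u' (t + s /\<^sub>R 2)))\<^sup>2 * (norm (v' (t - s /\<^sub>R 2)))\<^sup>2) \<partial>lborel \<partial>lborel)"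
  proof (intro nn_integral_mono)
    fix t s
    show "ennreal (F t s) \<le> ennreal 2 * ennreal ((norm (u (t + s /\<^sub>R 2)))\<^sup>2 * (norm (v (t - s /\<^sub>R 2)))\<^sup>2)
       + ennreal 2 * ennreal ((norm (u' (t + s /\<^sub>R 2)))\<^sup>2 * (norm (v' (t - s /\<^sub>R 2)))\<^sup>2)"
      using ennreal_leI[OF le[of t s]] by (subst (asm) ennreal_plus) (simp_all add: ennreal_mult)
  qed
  also have "\<dots> = ennreal 2 * ennreal ((l2norm u)\<^sup>2 * (l2norm v)\<^sup>2) + ennreal 2 * ennreal ((l2norm u')\<^sup>2 * (l2norm v')\<^sup>2)"
    unfolding nn_integral_corr_square[OF assms(1,2,5,6), symmetric] nn_integral_corr_square[OF assms(3,4,7,8), symmetric]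
    by (simp add: nn_integral_add nn_integral_cmult)
  also have "\<dots> < top"
    by (simp add: ennreal_mult_less_top)
  finally show ?thesis .
qed

text \<open>Only r \<ge> 0 is asked for, which suffices because c \<ge> 0 places the minimum of the
  quadratic at a non-negative r.\<close>

lemma discriminant_ennreal:
  assumes X: "X < top" and Y: "Y < top" and c: "0 \<le> c"
    and le: "\<And>r. 0 \<le> r \<Longrightarrow> ennreal (r * c) \<le> ennreal (r\<^sup>2) * X + Y"
  shows "ennreal (c\<^sup>2 / 4) \<le> X * Y"
proof -
  obtain x y where x: "X = ennreal x" "0 \<le> x" and y: "Y = ennreal y" "0 \<le> y"
    using X Y by (metis ennreal_cases top.not_eq_extremum)
  have q: "r * c \<le> r\<^sup>2 * x + y" if "0 \<le> r" for r
  proof -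
    have "ennreal (r * c) \<le> ennreal (r\<^sup>2 * x + y)"
      using le[OF that] x y by (simp add: ennreal_mult)
    then show ?thesis using x y by (subst (asm) ennreal_le_iff) auto
  qed
  have "c\<^sup>2 / 4 \<le> x * y"
  proof (cases "x = 0")
    case True
    have "c = 0"
    proof (rule ccontr)
      assume "c \<noteq> 0"
      \<comment> \<open>With x = 0 the bound reads r c \<le> y for all r \<ge> 0, and this r makes
        the left side y + 1.\<close>
      with c q[of "(y + 1) / c"] y True show False by simp
    qed
    then show ?thesis using True by simp
  next
    case False
    with x have x0: "x > 0" by simp
    \<comment> \<open>The minimiser of r^2 x - r c + y.\<close>
    have "c / (2 * x) * c \<le> (c / (2 * x))\<^sup>2 * x + y" using q[of "c / (2 * x)"] x0 c by simp
    then have "c / (2 * x) * c * x \<le> ((c / (2 * x))\<^sup>2 * x + y) * x"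
      using x0 by (intro mult_right_mono) auto
    then show ?thesis using x0 by (simp add: power2_eq_square field_simps)
  qed
  then show ?thesis using x y by (simp add: ennreal_leI flip: ennreal_mult)
qed

theorem theorem4p8:
  fixes \<nu> \<mu> :: quat
    and a b c d \<tau> \<eta> :: "2 \<Rightarrow> real"
    and A :: "2 \<Rightarrow> olct_param"
    and f g :: "real^2 \<Rightarrow> quat"
    and k :: 2
  assumes "pure_unit \<nu>" and "pure_unit \<mu>"
    and "\<And>l. A l = (a l, b l, c l, d l, \<tau> l, \<eta> l)"
    and "\<And>l. a l * d l - b l * c l = 1"
    and "\<And>l. b l \<noteq> 0"
    and "schwartz f" and "schwartz g"
  shows
    "(\<integral>\<^sup>+ t. \<integral>\<^sup>+ s. ennreal ((norm ((s $ k) *\<^sub>R (f (t + s /\<^sub>R 2) * qcnj (g (t - s /\<^sub>R 2)))))\<^sup>2)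
        \<partial>lborel \<partial>lborel) *
     (\<integral>\<^sup>+ t. \<integral>\<^sup>+ \<xi>. ennreal ((wvd_norm (\<xi> $ k / (2 * pi * b k)) \<nu> \<mu> (A 1) (A 2) f g t \<xi>)\<^sup>2)
        \<partial>lborel \<partial>lborel)
     \<ge> ennreal (1 / (16 * pi\<^sup>2) * (l2norm f) ^ 4 * (l2norm g) ^ 4)"
proof -
  note F = schwartzD[OF \<open>schwartz f\<close>] and G = schwartzD[OF \<open>schwartz g\<close>]
  define H where "H = wvd_corr f g"
  define H' where "H' = corr_deriv k f g"
  have HR: "has_dir_deriv (H t) (H' t) (axis k 1)" "rapid (H t)" "continuous_on UNIV (H t)"
    "rapid (H' t)" "continuous_on UNIV (H' t)" for t
    unfolding H_def H'_def by (rule wvd_corr_regularity[OF \<open>schwartz f\<close> \<open>schwartz g\<close>])+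
  define X where "X = (\<integral>\<^sup>+t. \<integral>\<^sup>+s. ennreal ((norm ((s $ k) *\<^sub>R H t s))\<^sup>2) \<partial>lborel \<partial>lborel)"
  define Y where "Y = (\<integral>\<^sup>+t. \<integral>\<^sup>+s. ennreal ((norm (H' t s))\<^sup>2) \<partial>lborel \<partial>lborel)"
  define W where "W = (\<integral>\<^sup>+ t. \<integral>\<^sup>+ \<xi>. ennreal ((wvd_norm (\<xi> $ k / (2 * pi * b k)) \<nu> \<mu> (A 1) (A 2) f g t \<xi>)\<^sup>2) \<partial>lborel \<partial>lborel)"
  define C where "C = (l2norm f)\<^sup>2 * (l2norm g)\<^sup>2"
  have [measurable]: "f \<in> borel_measurable borel" "g \<in> borel_measurable borel"
      "partial k f \<in> borel_measurable borel" "partial k g \<in> borel_measurable borel" "qcnj \<in> borel_measurable borel"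
    by (intro borel_measurable_continuous_onI F G linear_continuous_on bounded_linear_components)+
  have Hm: "(\<lambda>(t, s). H t s) \<in> borel_measurable (lborel \<Otimes>\<^sub>M lborel)"
    "(\<lambda>(t, s). H' t s) \<in> borel_measurable (lborel \<Otimes>\<^sub>M lborel)"
    unfolding H_def H'_def wvd_corr_def corr_deriv_def by measurable
  have Hm'[measurable]: "H t \<in> borel_measurable borel" "H' t \<in> borel_measurable borel" for t
    using HR by (auto intro: borel_measurable_continuous_onI)
  \<comment> \<open>The discriminant argument takes place in the reals and so needs \<open>X\<close>
    and \<open>Y\<close> finite; \<open>W\<close> may be infinite.\<close>
  have fin: "X < top"
    unfolding X_def
  proof (rule nn_integral_corr_finite[OF rapid_coord[OF F(1)] G(1) F(1) rapid_coord[OF G(1)]])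
    fix t s :: "real^2"
    \<comment> \<open>The weight s_k is shifted onto the arguments of f and g, where Schwartz decay
      absorbs it.\<close>
    have "s $ k = (t + s /\<^sub>R 2) $ k - (t - s /\<^sub>R 2) $ k" by simp
    moreover have "(x - y)\<^sup>2 \<le> 2 * x\<^sup>2 + 2 * y\<^sup>2" for x y :: real
      using zero_le_power2[of "x + y"] by (simp add: power2_eq_square algebra_simps)
    ultimately have "(s $ k)\<^sup>2 \<le> 2 * ((t + s /\<^sub>R 2) $ k)\<^sup>2 + 2 * ((t - s /\<^sub>R 2) $ k)\<^sup>2"
      by metis
    from mult_right_mono[OF this, of "(norm (f (t + s /\<^sub>R 2)) * norm (g (t - s /\<^sub>R 2)))\<^sup>2"]
    show "(norm ((s $ k) *\<^sub>R H t s))\<^sup>2 \<le>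
       2 * ((norm (((t + s /\<^sub>R 2) $ k) *\<^sub>R f (t + s /\<^sub>R 2)))\<^sup>2 * (norm (g (t - s /\<^sub>R 2)))\<^sup>2) +
       2 * ((norm (f (t + s /\<^sub>R 2)))\<^sup>2 * (norm (((t - s /\<^sub>R 2) $ k) *\<^sub>R g (t - s /\<^sub>R 2)))\<^sup>2)"
      unfolding H_def wvd_corr_def norm_scaleR norm_mult norm_qcnj power_mult_distrib power2_abs
      by (simp add: algebra_simps)
  qed measurable
  have finY: "Y < top"
    unfolding Y_def
  proof (rule nn_integral_corr_finite[OF F(1) G(3) F(3) G(1)])
    fix t s :: "real^2"
    define x where "x = norm (f (t + s /\<^sub>R 2)) * norm (partial k g (t - s /\<^sub>R 2))"
    define y where "y = norm (partial k f (t + s /\<^sub>R 2)) * norm (g (t - s /\<^sub>R 2))"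
    have "norm (H' t s) \<le> norm (f (t + s /\<^sub>R 2) * (- 1 / 2) *\<^sub>R qcnj (partial k g (t - s /\<^sub>R 2))) +
      norm ((1 / 2) *\<^sub>R partial k f (t + s /\<^sub>R 2) * qcnj (g (t - s /\<^sub>R 2)))"
      unfolding H'_def corr_deriv_def by (rule norm_triangle_ineq)
    also have "\<dots> = (x + y) / 2" by (simp add: x_def y_def norm_mult)
    also have "\<dots> \<le> x + y" by (simp add: x_def y_def)
    finally have "(norm (H' t s))\<^sup>2 \<le> (x + y)\<^sup>2" by (intro power_mono) auto
    also have "\<dots> \<le> 2 * x\<^sup>2 + 2 * y\<^sup>2"
      using zero_le_power2[of "x - y"] by (simp add: power2_eq_square algebra_simps)
    finally show "(norm (H' t s))\<^sup>2 \<le> 2 * ((norm (f (t + s /\<^sub>R 2)))\<^sup>2 * (norm (partial k g (t - s /\<^sub>R 2)))\<^sup>2)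
      + 2 * ((norm (partial k f (t + s /\<^sub>R 2)))\<^sup>2 * (norm (g (t - s /\<^sub>R 2)))\<^sup>2)"
      by (simp add: x_def y_def power_mult_distrib)
  qed measurable
  have C: "(\<integral>\<^sup>+t. \<integral>\<^sup>+s. ennreal ((norm (H t s))\<^sup>2) \<partial>lborel \<partial>lborel) = ennreal C"
    using nn_integral_corr_square[OF F(1) G(1)]
    by (simp add: H_def C_def wvd_corr_def norm_mult power_mult_distrib)
  have I: "integrable lborel (\<lambda>s. (norm (H t s))\<^sup>2)" "integrable lborel (\<lambda>s. (norm (H' t s))\<^sup>2)"
    "integrable lborel (\<lambda>s. (norm ((s $ k) *\<^sub>R H t s))\<^sup>2)" for t
    by (intro integrable_rapid_norm_square rapid_coord HR; measurable)+
  \<comment> \<open>The same r is used for every t and the inequality is integrated over t before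
    the discriminant is taken. This avoids a separate Cauchy-Schwarz inequality in t.\<close>
  have quad: "ennreal (r * C) \<le> ennreal (r\<^sup>2) * X + Y" if r: "0 \<le> r" for r
  proof -
    have "ennreal (r * C) = (\<integral>\<^sup>+t. ennreal r * (\<integral>\<^sup>+s. ennreal ((norm (H t s))\<^sup>2) \<partial>lborel) \<partial>lborel)"
      using r C Hm(1) by (subst nn_integral_cmult) (auto simp: ennreal_mult' intro!: lborel.borel_measurable_nn_integral)
    also have "\<dots> \<le> (\<integral>\<^sup>+t. ennreal (r\<^sup>2) * (\<integral>\<^sup>+s. ennreal ((norm ((s $ k) *\<^sub>R H t s))\<^sup>2) \<partial>lborel) +
        (\<integral>\<^sup>+s. ennreal ((norm (H' t s))\<^sup>2) \<partial>lborel) \<partial>lborel)"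
    proof (intro nn_integral_mono)
      fix t
      have i: "(\<integral>\<^sup>+s. ennreal ((norm (H t s))\<^sup>2) \<partial>lborel) = ennreal (LINT s|lborel. (norm (H t s))\<^sup>2)"
        "(\<integral>\<^sup>+s. ennreal ((norm (H' t s))\<^sup>2) \<partial>lborel) = ennreal (LINT s|lborel. (norm (H' t s))\<^sup>2)"
        "(\<integral>\<^sup>+s. ennreal ((norm ((s $ k) *\<^sub>R H t s))\<^sup>2) \<partial>lborel) = ennreal (LINT s|lborel. (norm ((s $ k) *\<^sub>R H t s))\<^sup>2)"
        by (rule nn_integral_eq_integral[OF I(1)] nn_integral_eq_integral[OF I(2)] nn_integral_eq_integral[OF I(3)]; simp)+
      have "r * (LINT s|lborel. (norm (H t s))\<^sup>2) \<le>
         r\<^sup>2 * (LINT s|lborel. (norm ((s $ k) *\<^sub>R H t s))\<^sup>2) + (LINT s|lborel. (norm (H' t s))\<^sup>2)"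
        by (rule weighted_uncertainty[OF HR(1,2) Hm'(1) HR(4) Hm'(2)])
      from ennreal_leI[OF this]
      show "ennreal r * (\<integral>\<^sup>+s. ennreal ((norm (H t s))\<^sup>2) \<partial>lborel) \<le>
        ennreal (r\<^sup>2) * (\<integral>\<^sup>+s. ennreal ((norm ((s $ k) *\<^sub>R H t s))\<^sup>2) \<partial>lborel) + (\<integral>\<^sup>+s. ennreal ((norm (H' t s))\<^sup>2) \<partial>lborel)"
        unfolding i using r by (subst (asm) ennreal_plus) (simp_all add: ennreal_mult del: norm_scaleR)
    qed
    also have "\<dots> = ennreal (r\<^sup>2) * X + Y"
    proof -
      have "(\<lambda>(t, s). ennreal ((norm ((s $ k) *\<^sub>R H t s))\<^sup>2)) \<in> borel_measurable (lborel \<Otimes>\<^sub>M lborel)"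
        "(\<lambda>(t, s). ennreal ((norm (H' t s))\<^sup>2)) \<in> borel_measurable (lborel \<Otimes>\<^sub>M lborel)"
        unfolding H_def H'_def wvd_corr_def corr_deriv_def by measurable
      from this[THEN lborel.borel_measurable_nn_integral]
      show ?thesis
        unfolding X_def Y_def by (simp add: nn_integral_add nn_integral_cmult del: norm_scaleR)
    qed
    finally show ?thesis .
  qed
  have XY: "ennreal (C\<^sup>2 / 4) \<le> X * Y"
    by (rule discriminant_ennreal[OF fin finY _ quad]) (simp_all add: C_def)
  have YW: "ennreal (1 / (4 * pi\<^sup>2)) * Y \<le> W"
  proof -
    have "ennreal (1 / (4 * pi\<^sup>2)) * Y = (\<integral>\<^sup>+t. ennreal (1 / (4 * pi\<^sup>2)) * (\<integral>\<^sup>+s. ennreal ((norm (H' t s))\<^sup>2) \<partial>lborel) \<partial>lborel)"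
      unfolding Y_def using Hm(2)
      by (intro nn_integral_cmult[symmetric]) (auto intro!: lborel.borel_measurable_nn_integral)
    also have "\<dots> \<le> W"
      unfolding W_def
    proof (intro nn_integral_mono)
      fix t
      have "ennreal (1 / (4 * pi\<^sup>2)) * (\<integral>\<^sup>+s. ennreal ((norm (H' t s))\<^sup>2) \<partial>lborel) = ennreal (1 / (4 * pi\<^sup>2) * (LINT s|lborel. (norm (H' t s))\<^sup>2))"
        using I(2) by (subst nn_integral_eq_integral) (simp_all flip: ennreal_mult)
      also have "\<dots> \<le> (\<integral>\<^sup>+ \<xi>. ennreal ((wvd_norm (\<xi> $ k / (2 * pi * b k)) \<nu> \<mu> (A 1) (A 2) f g t \<xi>)\<^sup>2) \<partial>lborel)"
        unfolding H'_def by (rule wvd_norm_ge[OF assms(1,2,3,5,6,7)])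
      finally show "ennreal (1 / (4 * pi\<^sup>2)) * (\<integral>\<^sup>+s. ennreal ((norm (H' t s))\<^sup>2) \<partial>lborel) \<le>
        (\<integral>\<^sup>+ \<xi>. ennreal ((wvd_norm (\<xi> $ k / (2 * pi * b k)) \<nu> \<mu> (A 1) (A 2) f g t \<xi>)\<^sup>2) \<partial>lborel)" .
    qed
    finally show ?thesis .
  qed
  \<comment> \<open>The constant splits into 1 / (4 pi^2) from the lower bound on \<open>W\<close>
    and 1/4 from the discriminant.\<close>
  have "1 / (16 * pi\<^sup>2) * (l2norm f) ^ 4 * (l2norm g) ^ 4 = 1 / (4 * pi\<^sup>2) * (C\<^sup>2 / 4)"
    by (simp add: C_def power_mult_distrib flip: power_mult)
  then have "ennreal (1 / (16 * pi\<^sup>2) * (l2norm f) ^ 4 * (l2norm g) ^ 4) = ennreal (1 / (4 * pi\<^sup>2)) * ennreal (C\<^sup>2 / 4)"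
    by (simp flip: ennreal_mult)
  also have "\<dots> \<le> ennreal (1 / (4 * pi\<^sup>2)) * (X * Y)"
    by (intro mult_left_mono XY) simp
  also have "\<dots> = X * (ennreal (1 / (4 * pi\<^sup>2)) * Y)"
    by (simp only: mult_ac)
  also have "\<dots> \<le> X * W"
    by (intro mult_left_mono YW) simp
  finally show ?thesis
    unfolding X_def W_def H_def wvd_corr_def .
qed

end
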